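(* Let $\sigma$ be a distribution on $\mathbb{R}^d$ of type $\mathrm{mult}G$, that is, let $\sigma=\mathcal{L}(Z^{1/2}X)$, where $X$ is a standard Gaussian on $\mathbb{R}^d$, $Z$ is an $\mathbf{S}_d^+$-valued infinitely divisible random variable, $Z^{1/2}$ is the nonnegative-definite symmetric square root of $Z$, and $X$ and $Z$ are independent. (i) Let $m\in\{0,1,\ldots,\infty\}$ and $b>1$. If $\mathcal{L}(Z)\in L_m(b^{-1},\mathbb{R}^{d(d+1)/2})$, then $\sigma\in L_m(b^{-1/2},\mathbb{R}^d)$. (ii) Let $0<\alpha'\le1$ and $b>1$. If $\mathcal{L}(Z)$ is strictly $\alpha'$-semistable with a span $b$, then $\sigma$ is strictly $2\alpha'$-semistable with a span $b^{1/2}$.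
   Context: $\mathcal{L}(Y)$ denotes the law of a random variable $Y$. $\mathbf{S}_d^+$ is the set of $d\times d$ real symmetric nonnegative-definite matrices; elements of $\mathbb{R}^d$ are column vectors. Regarding the lower triangle $(s_{jk})_{k\le j}$ of $s=(s_{jk})_{j,k=1}^d\in\mathbf{S}_d^+$ as a $d(d+1)/2$-vector, $\mathbf{S}_d^+$ is identified with a subset (a closed convex cone) of $\mathbb{R}^{d(d+1)/2}$, and $\mathcal{L}(Z)$ is regarded as a distribution on $\mathbb{R}^{d(d+1)/2}$. $\widehat\mu$ denotes the characteristic function of $\mu$, and $ID(\mathbb{R}^n)$ is the class of infinitely divisible distributions on $\mathbb{R}^n$. For $\mu\in ID(\mathbb{R}^n)$ and real $t\ge0$, $\widehat\mu(z)^t$ denotes the characteristic function of the $t$-th convolution power of $\mu$ (i.e. $e^{t\log\widehat\mu(z)}$ with the continuous logarithm vanishing at $z=0$). Classes $L_m(b^{-1},\mathbb{R}^n)$, for $b>1$: $L_0(b^{-1},\mathbb{R}^n)$ is the class of distributions $\mu$ on $\mathbb{R}^n$ for which there is $\mu'\in ID(\mathbb{R}^n)$ with $\widehat\mu(z)=\widehat\mu(b^{-1}z)\,\widehat{\mu'}(z)$ for all $z\in\mathbb{R}^n$ (semi-selfdecomposable distributions with $b$ as a span). Such $\mu$ is infinitely divisible and $\mu'$ is uniquely determined by $\mu$ and $b$. For integers $m\ge1$, inductively, $L_m(b^{-1},\mathbb{R}^n)=\{\mu\in L_0(b^{-1},\mathbb{R}^n)\colon \mu'\in L_{m-1}(b^{-1},\mathbb{R}^n)\}$.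 Finally $L_\infty(b^{-1},\mathbb{R}^n)=\bigcap_{m=0}^{\infty}L_m(b^{-1},\mathbb{R}^n)$. (Thus $L_m(b^{-1/2},\mathbb{R}^d)$ is the class with $b$ replaced by $b^{1/2}$.) For $0<\alpha\le2$, a distribution $\mu$ on $\mathbb{R}^n$ is strictly $\alpha$-semistable with a span $b>1$ if $\mu\in ID(\mathbb{R}^n)$ and $\widehat\mu(z)^{b^\alpha}=\widehat\mu(bz)$ for all $z\in\mathbb{R}^n$. *)

theory Defs
  imports "HOL-Probability.Probability" "HOL-Library.Extended_Nat"
begin

section \<open>Symmetric nonnegative-definite matrices\<close>

definition psd_mats :: "(real^'d^'d) set" where
  "psd_mats = {s. transpose s = s \<and> (\<forall>x. 0 \<le> x \<bullet> (s *v x))}"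

definition psd_sqrt :: "real^'d^'d \<Rightarrow> real^'d^'d" where
  "psd_sqrt s = (THE r. r \<in> psd_mats \<and> r ** r = s)"

text \<open>Positions (row, column) of the lower triangle of a matrix. This is the index type of
  the coordinates of the space \<open>\<real>\<^bsup>d(d+1)/2\<^esup>\<close>, where \<open>d = CARD('d)\<close>; the linear order on \<open>'d\<close>
  serves only to say what the lower triangle is.\<close>

typedef (overloaded) 'd ltri = "{(j, k). k \<le> j} :: ('d :: linorder \<times> 'd) set"
proof -
  have "(undefined, undefined) \<in> {(j, k). k \<le> (j :: 'd)}" by simp
  then show ?thesis by blast
qed

instance ltri :: ("{finite, linorder}") finite
proof
  have "(UNIV :: 'a ltri set) = Abs_ltri ` {(j, k). k \<le> j}"
    by (metis type_definition.Abs_image type_definition_ltri)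
  then show "finite (UNIV :: 'a ltri set)" by (metis finite_imageI finite)
qed

lemma card_ltri:
  "CARD('d :: {finite, linorder} ltri) = CARD('d) * (CARD('d) + 1) div 2"
proof -
  let ?L = "{(j, k). k \<le> j} :: ('d \<times> 'd) set"
  let ?U = "{(j, k). j \<le> k} :: ('d \<times> 'd) set"
  have "CARD('d ltri) = card ?L"
    by (rule type_definition.card [OF type_definition_ltri])
  moreover have "card ?U = card ?L"
    by (rule bij_betw_same_card [of prod.swap])
       (auto simp: bij_betw_def inj_on_def image_iff)
  moreover have "card ?L + card ?U = card (?L \<union> ?U) + card (?L \<inter> ?U)"
    by (rule card_Un_Int) simp_all
  moreover have "?L \<union> ?U = UNIV \<times> UNIV" by auto
  moreover have "?L \<inter> ?U = (\<lambda>j. (j, j)) ` UNIV" by auto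
  moreover have "card ((\<lambda>j :: 'd. (j, j)) ` UNIV) = CARD('d)"
    by (rule card_image) (simp add: inj_on_def)
  ultimately show ?thesis by (simp add: card_cartesian_product)
qed

definition lower_tri ::
    "real^('d :: {finite, linorder})^('d :: {finite, linorder}) \<Rightarrow> real^(('d :: {finite, linorder}) ltri)" where
  "lower_tri s = (\<chi> p. s $ fst (Rep_ltri p) $ snd (Rep_ltri p))"

section \<open>Distributions, characteristic functions and infinite divisibility\<close>

definition distributions :: "(real^'n) measure set" where
  "distributions = {\<mu>. prob_space \<mu> \<and> sets \<mu> = sets borel}"

definition charfun :: "(real^'n) measure \<Rightarrow> real^'n \<Rightarrow> complex" where
  "charfun \<mu> z = (CLINT x|\<mu>. cis (z \<bullet> x))"

primrec conv_power :: "(real^'n) measure \<Rightarrow> nat \<Rightarrow> (real^'n) measure" where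
  "conv_power \<nu> 0 = return borel 0"
| "conv_power \<nu> (Suc k) = convolution \<nu> (conv_power \<nu> k)"

definition inf_divisible :: "(real^'n) measure set" where
  "inf_divisible =
     {\<mu> \<in> distributions. \<forall>k\<ge>1. \<exists>\<nu>\<in>distributions. \<mu> = conv_power \<nu> k}"

text \<open>The continuous logarithm of the characteristic function that vanishes at the origin.
  It exists, and is unique, whenever the characteristic function has no zero; in particular
  this is the case for infinitely divisible distributions.\<close>

definition log_charfun :: "(real^'n) measure \<Rightarrow> real^'n \<Rightarrow> complex" where
  "log_charfun \<mu> =
     (THE \<phi>. continuous_on UNIV \<phi> \<and> \<phi> 0 = 0 \<and> (\<forall>z. exp (\<phi> z) = charfun \<mu> z))"

definition charfun_powr :: "(real^'n) measure \<Rightarrow> real \<Rightarrow> real^'n \<Rightarrow> complex" where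
  "charfun_powr \<mu> t z = exp (of_real t * log_charfun \<mu> z)"

section \<open>The classes \<open>L\<^sub>m\<close> and strict semistability\<close>

text \<open>The parameter \<open>c\<close> is the reciprocal of the span: \<open>L\<^sub>m(b\<^sup>-\<^sup>1, \<real>\<^sup>n)\<close> is obtained with
  \<open>c = 1/b\<close>, \<open>b > 1\<close>. The measure \<open>\<mu>'\<close> below is uniquely determined by \<open>\<mu>\<close> and \<open>c\<close>.\<close>

definition semi_sd_factor :: "real \<Rightarrow> (real^'n) measure \<Rightarrow> (real^'n) measure \<Rightarrow> bool" where
  "semi_sd_factor c \<mu> \<mu>' \<longleftrightarrow>
     \<mu>' \<in> inf_divisible \<and> (\<forall>z. charfun \<mu> z = charfun \<mu> (c *\<^sub>R z) * charfun \<mu>' z)"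

primrec L_fin :: "nat \<Rightarrow> real \<Rightarrow> (real^'n) measure set" where
  "L_fin 0 c = {\<mu> \<in> distributions. \<exists>\<mu>'. semi_sd_factor c \<mu> \<mu>'}"
| "L_fin (Suc m) c =
     {\<mu> \<in> distributions. \<exists>\<mu>'. semi_sd_factor c \<mu> \<mu>' \<and> \<mu>' \<in> L_fin m c}"

definition L_class :: "enat \<Rightarrow> real \<Rightarrow> (real^'n) measure set" where
  "L_class m c = (case m of enat k \<Rightarrow> L_fin k c | \<infinity> \<Rightarrow> (\<Inter>k. L_fin k c))"

definition strictly_semistable :: "real \<Rightarrow> real \<Rightarrow> (real^'n) measure \<Rightarrow> bool" where
  "strictly_semistable \<alpha> b \<mu> \<longleftrightarrow>
     0 < \<alpha> \<and> \<alpha> \<le> 2 \<and> 1 < b \<and> \<mu> \<in> inf_divisible \<and>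
     (\<forall>z. charfun_powr \<mu> (b powr \<alpha>) z = charfun \<mu> (b *\<^sub>R z))"

section \<open>Type \<open>multG\<close>\<close>

definition std_gaussian :: "'w measure \<Rightarrow> ('w \<Rightarrow> real^'d) \<Rightarrow> bool" where
  "std_gaussian M X \<longleftrightarrow>
     distributed M lborel X (\<lambda>x. ennreal (\<Prod>i\<in>UNIV. std_normal_density (x $ i)))"

text \<open>The constant \<open>prob_space.indep_var\<close> requires both variables to have the same type,
  so independence of a vector and a matrix is stated through the generated
  \<open>\<sigma>\<close>-algebras.\<close>

definition indep_vec_mat ::
    "'w measure \<Rightarrow> ('w \<Rightarrow> real^'d) \<Rightarrow> ('w \<Rightarrow> real^'d^'d) \<Rightarrow> bool" where
  "indep_vec_mat M X Z \<longleftrightarrow>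
     prob_space.indep_set M {X -` A \<inter> space M |A. A \<in> sets borel}
                            {Z -` B \<inter> space M |B. B \<in> sets borel}"

definition tri_law ::
    "'w measure \<Rightarrow> ('w \<Rightarrow> real^('d :: {finite, linorder})^('d :: {finite, linorder}))
      \<Rightarrow> (real^(('d :: {finite, linorder}) ltri)) measure" where
  "tri_law M Z = distr M borel (\<lambda>\<omega>. lower_tri (Z \<omega>))"

definition multG_repr ::
    "'w measure \<Rightarrow> ('w \<Rightarrow> real^('d :: {finite, linorder}))
      \<Rightarrow> ('w \<Rightarrow> real^('d :: {finite, linorder})^('d :: {finite, linorder}))
      \<Rightarrow> (real^('d :: {finite, linorder})) measure \<Rightarrow> bool" where
  "multG_repr M X Z \<sigma> \<longleftrightarrow>
     prob_space M \<and>
     std_gaussian M X \<and>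
     Z \<in> borel_measurable M \<and> (\<forall>\<omega>\<in>space M. Z \<omega> \<in> psd_mats) \<and>
     tri_law M Z \<in> inf_divisible \<and>
     indep_vec_mat M X Z \<and>
     \<sigma> = distr M borel (\<lambda>\<omega>. psd_sqrt (Z \<omega>) *v X \<omega>)"

end

theory Submission
  imports Defs
begin

text \<open>For a distribution \<open>\<mu>\<close> carried by the cone of nonnegative-definite matrices, the mixture
  \<open>mix \<mu>\<close>, i.e. the law of \<open>Z\<^sup>1\<^sup>/\<^sup>2 X\<close> with \<open>Z\<close> distributed as \<open>\<mu>\<close>, has as characteristic function
  at \<open>z\<close> the Laplace transform of \<open>\<mu>\<close> at \<open>q\<^sub>z / 2\<close>, where \<open>q\<^sub>z\<close> is the linear functional
  \<open>s \<mapsto> z \<bullet> s z\<close>. Since \<open>q\<close> is quadratic in \<open>z\<close>, replacing \<open>z\<close> by \<open>b\<^sup>1\<^sup>/\<^sup>2 z\<close> amounts to rescaling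
  \<open>\<mu>\<close> by \<open>b\<close>, and convolution identities for \<open>\<mu>\<close> become convolution identities for \<open>mix \<mu>\<close>
  as soon as all factors are carried by the cone. For convolution roots this holds because a half-space
  \<open>w \<bullet> x < 0\<close> charged by the root would be charged by its powers; for the factors \<open>\<mu>'\<close> in the
  definition of \<open>L\<^sub>m\<close> it follows by improving essential lower bounds of \<open>w \<bullet> x\<close> indefinitely.\<close>

section \<open>Square roots of nonnegative-definite matrices\<close>

lemma psd_mats_closed_forms:
  "psd_mats = (\<Inter>i j. {s :: real^'d^'d. s $ i $ j = s $ j $ i}) \<inter> (\<Inter>x. {s. 0 \<le> x \<bullet> (s *v x)})"
  unfolding psd_mats_def transpose_def vec_eq_iff by auto

lemma closed_psd_mats: "closed (psd_mats :: (real^'d^'d) set)"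
  unfolding psd_mats_closed_forms matrix_vector_mult_def inner_vec_def
  by (intro closed_Int closed_INT ballI closed_Collect_eq closed_Collect_le continuous_intros)

lemma symmetric_dot:
  fixes s :: "real^'d^'d"
  assumes "transpose s = s"
  shows "x \<bullet> (s *v y) = (s *v x) \<bullet> y"
  by (metis assms dot_lmul_matrix vector_transpose_matrix)

lemma psd_Cauchy_Schwarz:
  assumes s: "s \<in> psd_mats"
  shows "(x \<bullet> (s *v y))\<^sup>2 \<le> (x \<bullet> (s *v x)) * (y \<bullet> (s *v y))"
proof -
  define a b c where "a = x \<bullet> (s *v x)" and "b = x \<bullet> (s *v y)" and "c = y \<bullet> (s *v y)"
  have b': "y \<bullet> (s *v x) = b"
    using symmetric_dot[of s y x] s by (simp add: psd_mats_def b_def inner_commute)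
  have pos: "0 \<le> u\<^sup>2 * a + 2 * u * v * b + v\<^sup>2 * c" for u v
  proof -
    have "0 \<le> (u *\<^sub>R x + v *\<^sub>R y) \<bullet> (s *v (u *\<^sub>R x + v *\<^sub>R y))"
      using s unfolding psd_mats_def by blast
    also have "\<dots> = u\<^sup>2 * a + 2 * u * v * b + v\<^sup>2 * c"
      using b' by (simp add: matrix_vector_right_distrib matrix_vector_mult_scaleR
          inner_simps a_def b_def c_def power2_eq_square algebra_simps)
    finally show ?thesis .
  qed
  have a0: "0 \<le> a" and c0: "0 \<le> c" using s by (auto simp: psd_mats_def a_def c_def)
  show ?thesis unfolding a_def[symmetric] b_def[symmetric] c_def[symmetric]
  proof (cases "c = 0")
    case True
    \<comment> \<open>The form vanishes at y, so at b x - (a + 1) y it equals - b^2 (a + 2), which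
      is negative unless b = 0.\<close>
    have "0 \<le> b\<^sup>2 * a + 2 * b * (- (a + 1)) * b"
      using pos[of b "- (a + 1)"] True by simp
    then have "b\<^sup>2 * (a + 2) \<le> 0" by (simp add: power2_eq_square algebra_simps)
    then have "b = 0" using a0 by (simp add: mult_le_0_iff)
    then show "b\<^sup>2 \<le> a * c" using a0 c0 by simp
  next
    case False
    \<comment> \<open>At c x - b y the form equals c (a c - b^2).\<close>
    have "0 \<le> c * (a * c - b\<^sup>2)"
      using pos[of c "- b"] by (simp add: power2_eq_square algebra_simps)
    then show "b\<^sup>2 \<le> a * c" using False c0 by (simp add: zero_le_mult_iff)
  qed
qed

lemma psd_mult_eq_0:
  assumes s: "s \<in> psd_mats" and "x \<bullet> (s *v x) = 0"
  shows "s *v x = 0"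
  using psd_Cauchy_Schwarz[OF s, of "s *v x" x] assms(2) by simp

text \<open>With y = s x, Cauchy-Schwarz gives |y|^4 <= (y . s y) (x . s x) <= |y|^2 |x|^2, and one
  factor |y|^2 cancels.\<close>

lemma psd_form_contraction:
  assumes s: "s \<in> psd_mats" and le: "\<And>x. x \<bullet> (s *v x) \<le> (norm x)\<^sup>2"
  shows "norm (s *v x) \<le> norm x"
proof (cases "s *v x = 0")
  case False
  define y where "y = s *v x"
  have pos: "0 \<le> z \<bullet> (s *v z)" for z using s by (simp add: psd_mats_def)
  have "((norm y)\<^sup>2)\<^sup>2 \<le> (y \<bullet> (s *v y)) * (x \<bullet> (s *v x))"
    using psd_Cauchy_Schwarz[OF s, of y x] by (simp add: y_def dot_square_norm)
  also have "\<dots> \<le> (norm y)\<^sup>2 * (norm x)\<^sup>2"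
    by (intro mult_mono le pos) simp
  finally have "(norm y)\<^sup>2 * (norm y)\<^sup>2 \<le> (norm y)\<^sup>2 * (norm x)\<^sup>2"
    by (simp add: power2_eq_square)
  then have "(norm y)\<^sup>2 \<le> (norm x)\<^sup>2"
    by (rule mult_left_le_imp_le) (simp add: y_def False)
  then show ?thesis by (simp add: y_def power2_le_iff_abs_le)
qed simp

lemma matrix_mult_diff_distrib:
  fixes A B C :: "real^'n^'n"
  shows "A ** (B - C) = A ** B - A ** C" and "(A - B) ** C = A ** C - B ** C"
  by (vector matrix_matrix_mult_def sum_subtractf[symmetric] algebra_simps)+

text \<open>With \<open>D = r - t\<close> one has \<open>r D + D t = 0\<close>, so the nonnegative traces of \<open>D r D\<close> and \<open>D t D\<close>
  add up to \<open>0\<close>; hence both vanish and \<open>r D = t D = 0\<close>.\<close>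

lemma psd_sqrt_unique:
  fixes r t :: "real^'d^'d"
  assumes r: "r \<in> psd_mats" and t: "t \<in> psd_mats" and eq: "r ** r = t ** t"
  shows "r = t"
proof -
  define D where "D = r - t"
  have sym: "transpose D = D"
    using r t by (simp add: psd_mats_def D_def transpose_def vec_eq_iff)
  have rD: "r ** D + D ** t = 0"
    using eq by (simp add: D_def matrix_mult_diff_distrib)
  \<comment> \<open>The trace of D s D is the sum of the quadratic form of s over the columns of D,
    hence nonnegative for s in the cone.\<close>
  have tr: "trace (D ** (s ** D)) = (\<Sum>i\<in>UNIV. (D *v axis i 1) \<bullet> (s *v (D *v axis i 1)))" for s
    unfolding trace_def
  proof (intro sum.cong refl)
    fix i
    have "(D ** (s ** D)) $ i $ i = axis i 1 \<bullet> ((D ** (s ** D)) *v axis i 1)"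
      by (simp add: inner_axis' matrix_vector_mult_basis column_def)
    also have "\<dots> = axis i 1 \<bullet> (D *v (s *v (D *v axis i 1)))"
      by (simp only: matrix_vector_mul_assoc)
    also have "\<dots> = (D *v axis i 1) \<bullet> (s *v (D *v axis i 1))"
      by (rule symmetric_dot[OF sym])
    finally show "(D ** (s ** D)) $ i $ i = (D *v axis i 1) \<bullet> (s *v (D *v axis i 1))" .
  qed
  \<comment> \<open>By cyclicity D t D and D D t have the same trace.\<close>
  have "trace (D ** (r ** D)) + trace (D ** (t ** D)) = trace (D ** (r ** D)) + trace (D ** (D ** t))"
    by (metis matrix_mul_assoc trace_mul_sym)
  also have "\<dots> = trace (D ** (r ** D + D ** t))"
    by (simp add: matrix_add_ldistrib trace_add)
  also have "\<dots> = 0" by (simp add: rD trace_def)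
  finally have sum0: "trace (D ** (r ** D)) + trace (D ** (t ** D)) = 0" .
  have rp: "0 \<le> y \<bullet> (r *v y)" and tp: "0 \<le> y \<bullet> (t *v y)" for y
    using r t by (simp_all add: psd_mats_def)
  have "trace (D ** (r ** D)) \<ge> 0" "trace (D ** (t ** D)) \<ge> 0"
    unfolding tr by (intro sum_nonneg rp tp)+
  then have "trace (D ** (r ** D)) = 0" "trace (D ** (t ** D)) = 0"
    using sum0 by linarith+
  then have "r *v (D *v axis i 1) = 0" "t *v (D *v axis i 1) = 0" for i
    unfolding tr using r t
    by (auto simp: sum_nonneg_eq_0_iff rp tp intro!: psd_mult_eq_0)
  then have "D *v (D *v axis i 1) = 0" for i
    \<comment> \<open>Only the outer D is expanded to r - t; the inner column of D stays as it
      is.\<close>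
    unfolding D_def[THEN arg_cong, of "\<lambda>D'. D' *v (D *v axis i 1)"]
    by (simp add: matrix_vector_mult_diff_rdistrib)
  then have "(D *v axis i 1) \<bullet> (D *v axis i 1) = 0" for i
    by (simp flip: symmetric_dot[OF sym])
  then have "column i D = 0" for i
    by (simp add: matrix_vector_mult_basis)
  then have "D = 0" by (simp add: vec_eq_iff column_def)
  then show ?thesis by (simp add: D_def)
qed

text \<open>By symmetry the rows are the images of the unit vectors. The resulting boundedness
  supplies compactness twice: for Brouwer's theorem and for sequences of square roots.\<close>

lemma norm_symmetric_le:
  fixes Y :: "real^'d^'d"
  assumes sym: "transpose Y = Y" and le: "\<And>i. norm (Y *v axis i 1) \<le> B"
  shows "norm Y \<le> real CARD('d) * B"
proof -
  have "norm (Y $ i) \<le> B" for i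
  proof -
    have "Y $ i = column i Y" using sym by (metis row_def row_transpose vec_lambda_eta)
    then have "Y $ i = Y *v axis i 1" by (simp add: matrix_vector_mult_basis)
    then show ?thesis using le[of i] by simp
  qed
  then have "(\<Sum>i\<in>UNIV. norm (Y $ i)) \<le> (\<Sum>i\<in>(UNIV::'d set). B)" by (intro sum_mono)
  moreover have "norm Y \<le> (\<Sum>i\<in>UNIV. norm (Y $ i))"
    unfolding norm_vec_def by (rule L2_set_le_sum) simp
  ultimately show ?thesis by simp
qed

text \<open>If \<open>Y = (A + Y\<^sup>2) / 2\<close> then \<open>(1 - Y)\<^sup>2 = 1 - A\<close>; such a \<open>Y\<close> is given by Brouwer's theorem on the
  compact convex set of symmetric contractions.\<close>

lemma sqrt_exists_contraction:
  fixes A :: "real^'d^'d"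
  assumes sym: "transpose A = A" and le: "\<And>x. norm (A *v x) \<le> norm x"
  obtains r where "r \<in> psd_mats" "r ** r = mat 1 - A"
proof -
  define S :: "(real^'d^'d) set" where "S = {Y. transpose Y = Y \<and> (\<forall>x. norm (Y *v x) \<le> norm x)}"
  define F where "F Y = (1/2) *\<^sub>R (A + Y ** Y)" for Y
  have "closed ((\<Inter>i j. {Y :: real^'d^'d. Y $ i $ j = Y $ j $ i}) \<inter> (\<Inter>x. {Y. norm (Y *v x) \<le> norm x}))"
    unfolding matrix_vector_mult_def
    by (intro closed_Int closed_INT ballI closed_Collect_eq closed_Collect_le continuous_intros)
  also have "(\<Inter>i j. {Y :: real^'d^'d. Y $ i $ j = Y $ j $ i}) \<inter> (\<Inter>x. {Y. norm (Y *v x) \<le> norm x}) = S"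
    unfolding S_def transpose_def vec_eq_iff by auto
  finally have cl: "closed S" .
  have bd: "bounded S"
  proof (rule boundedI)
    fix Y assume "Y \<in> S"
    then have Y: "transpose Y = Y" "\<And>x. norm (Y *v x) \<le> norm x" by (auto simp: S_def)
    have "norm (Y *v axis i 1) \<le> 1" for i using Y(2)[of "axis i 1"] by simp
    then show "norm Y \<le> real CARD('d) * 1" by (rule norm_symmetric_le[OF Y(1)])
  qed
  have cv: "convex S"
  proof (rule convexI)
    fix X Y :: "real^'d^'d" and u v :: real assume h: "X \<in> S" "Y \<in> S" "0 \<le> u" "0 \<le> v" "u + v = 1"
    have "transpose (u *\<^sub>R X + v *\<^sub>R Y) = u *\<^sub>R X + v *\<^sub>R Y"
      using h by (simp add: S_def transpose_def vec_eq_iff)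
    moreover have "norm ((u *\<^sub>R X + v *\<^sub>R Y) *v x) \<le> norm x" for x
    proof -
      have "(u *\<^sub>R X + v *\<^sub>R Y) *v x = u *\<^sub>R (X *v x) + v *\<^sub>R (Y *v x)"
        by (simp add: matrix_vector_mult_add_rdistrib scaleR_matrix_vector_assoc)
      also have "norm \<dots> \<le> u * norm (X *v x) + v * norm (Y *v x)"
        using norm_triangle_ineq[of "u *\<^sub>R (X *v x)" "v *\<^sub>R (Y *v x)"] h by simp
      also have "\<dots> \<le> u * norm x + v * norm x"
        using h by (intro add_mono mult_left_mono) (auto simp: S_def)
      finally show ?thesis using h by (simp flip: distrib_right)
    qed
    ultimately show "u *\<^sub>R X + v *\<^sub>R Y \<in> S" by (simp add: S_def)
  qed
  have "A \<in> S" using sym le by (simp add: S_def)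
  moreover have "continuous_on S F"
    unfolding F_def matrix_matrix_mult_def by (intro continuous_intros)
  moreover have "F \<in> S \<rightarrow> S"
  proof
    fix Y assume "Y \<in> S"
    then have Y: "transpose Y = Y" "\<And>x. norm (Y *v x) \<le> norm x" by (auto simp: S_def)
    have "transpose (Y ** Y) = Y ** Y" by (simp add: matrix_transpose_mul Y)
    then have "transpose (F Y) = F Y" using sym by (simp add: F_def transpose_def vec_eq_iff)
    moreover have "norm (F Y *v x) \<le> norm x" for x
    proof -
      have "F Y *v x = (1/2) *\<^sub>R (A *v x + Y *v (Y *v x))"
        by (simp add: F_def matrix_vector_mult_add_rdistrib matrix_vector_mul_assoc flip: scaleR_matrix_vector_assoc)
      also have "norm \<dots> \<le> (norm (A *v x) + norm (Y *v (Y *v x))) / 2"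
        using norm_triangle_ineq[of "A *v x" "Y *v (Y *v x)"] by simp
      also have "\<dots> \<le> norm x" using le[of x] Y(2)[of x] Y(2)[of "Y *v x"] by simp
      finally show ?thesis .
    qed
    ultimately show "F Y \<in> S" by (simp add: S_def)
  qed
  ultimately obtain Y where Y: "Y \<in> S" "F Y = Y"
    using brouwer[of S F] cl bd cv compact_eq_bounded_closed by (metis empty_iff)
  show ?thesis
  proof
    show "mat 1 - Y \<in> psd_mats"
    proof -
      have "transpose (mat 1 - Y) = mat 1 - Y"
        using Y(1) by (simp add: S_def transpose_def vec_eq_iff mat_def)
      moreover have "0 \<le> x \<bullet> ((mat 1 - Y) *v x)" for x
      proof -
        have "x \<bullet> (Y *v x) \<le> norm x * norm (Y *v x)" by (rule norm_cauchy_schwarz)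
        also have "\<dots> \<le> norm x * norm x" using Y(1) by (intro mult_left_mono) (auto simp: S_def)
        finally show ?thesis
          by (simp add: matrix_vector_mult_diff_rdistrib inner_diff_right dot_square_norm power2_eq_square)
      qed
      ultimately show ?thesis by (simp add: psd_mats_def)
    qed
    have "(2::real) *\<^sub>R Y = A + Y ** Y" by (subst Y(2)[symmetric]) (simp add: F_def)
    then show "(mat 1 - Y) ** (mat 1 - Y) = mat 1 - A"
      by (simp add: matrix_mult_diff_distrib algebra_simps scaleR_2)
  qed
qed

lemma psd_mats_scaleR: "0 \<le> c \<Longrightarrow> s \<in> psd_mats \<Longrightarrow> c *\<^sub>R s \<in> psd_mats"
  by (simp add: psd_mats_def transpose_def vec_eq_iff scaleR_matrix_vector_assoc[symmetric])

text \<open>After division by a bound K of the operator, u = s / K lies between 0 and 1 as a form.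
  Hence 1 - u is a symmetric contraction, u = 1 - (1 - u) has a root, and that root is rescaled by
  sqrt K.\<close>

lemma psd_sqrt_exists:
  fixes s :: "real^'d^'d"
  assumes s: "s \<in> psd_mats"
  obtains r where "r \<in> psd_mats" "r ** r = s"
proof -
  obtain K where K: "K > 0" "\<And>x. norm (s *v x) \<le> norm x * K"
    using bounded_linear.pos_bounded[OF matrix_vector_mul_bounded_linear[of s]] by blast
  define u where "u = (1 / K) *\<^sub>R s"
  have u: "u \<in> psd_mats" unfolding u_def using K s by (intro psd_mats_scaleR) auto
  have "x \<bullet> (u *v x) \<le> (norm x)\<^sup>2" for x
  proof -
    have "x \<bullet> (u *v x) = (x \<bullet> (s *v x)) / K"
      by (simp add: u_def flip: scaleR_matrix_vector_assoc)
    also have "\<dots> \<le> norm x * (norm x * K) / K"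
      using K norm_cauchy_schwarz[of x "s *v x"] mult_left_mono[OF K(2), of "norm x" x]
      by (intro divide_right_mono) auto
    finally show ?thesis using K by (simp add: power2_eq_square)
  qed
  moreover have "transpose (mat 1 - u) = mat 1 - u"
    using u by (simp add: psd_mats_def transpose_def vec_eq_iff mat_def)
  ultimately have "mat 1 - u \<in> psd_mats"
    by (simp add: psd_mats_def matrix_vector_mult_diff_rdistrib inner_diff_right dot_square_norm)
  moreover have "x \<bullet> ((mat 1 - u) *v x) \<le> (norm x)\<^sup>2" for x
    using u by (simp add: psd_mats_def matrix_vector_mult_diff_rdistrib inner_diff_right dot_square_norm)
  ultimately have "norm ((mat 1 - u) *v x) \<le> norm x" for x
    by (intro psd_form_contraction)
  with \<open>transpose (mat 1 - u) = mat 1 - u\<close>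
  obtain r where r: "r \<in> psd_mats" "r ** r = mat 1 - (mat 1 - u)"
    by (rule sqrt_exists_contraction)
  have "(sqrt K *\<^sub>R r) ** (sqrt K *\<^sub>R r) = K *\<^sub>R (r ** r)"
    using K by (simp add: matrix_scalar_ac flip: scalar_matrix_assoc)
  also have "\<dots> = s" using r K by (simp add: u_def)
  finally show ?thesis using that[of "sqrt K *\<^sub>R r"] psd_mats_scaleR[of "sqrt K" r] r K by auto
qed

lemma
  assumes "s \<in> psd_mats"
  shows psd_sqrt_mem: "psd_sqrt s \<in> psd_mats" and psd_sqrt_mult: "psd_sqrt s ** psd_sqrt s = s"
proof -
  have "\<exists>!r. r \<in> psd_mats \<and> r ** r = s"
    using psd_sqrt_exists[OF assms] psd_sqrt_unique by metis
  from theI'[OF this] show "psd_sqrt s \<in> psd_mats" "psd_sqrt s ** psd_sqrt s = s"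
    by (simp_all add: psd_sqrt_def)
qed

section \<open>Continuity and measurability of the square root on the cone\<close>

lemma norm_psd_sqrt_mult:
  assumes s: "s \<in> psd_mats"
  shows "(norm (psd_sqrt s *v x))\<^sup>2 = x \<bullet> (s *v x)"
proof -
  have "transpose (psd_sqrt s) = psd_sqrt s"
    using psd_sqrt_mem[OF s] by (simp add: psd_mats_def)
  then have "(norm (psd_sqrt s *v x))\<^sup>2 = x \<bullet> (psd_sqrt s *v (psd_sqrt s *v x))"
    by (simp add: symmetric_dot power2_norm_eq_inner)
  then show ?thesis by (simp add: matrix_vector_mul_assoc psd_sqrt_mult[OF s])
qed

text \<open>Expresses continuity of the square root on the cone. The roots of a convergent sequence
  are bounded; a limit point of them lies in the cone and squares to the limit matrix, so uniqueness
  identifies it.\<close>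

lemma closed_psd_sqrt_vimage:
  fixes C :: "(real^'d^'d) set"
  assumes C: "closed C"
  shows "closed {s \<in> psd_mats. psd_sqrt s \<in> C}"
  unfolding closed_sequential_limits
proof (intro allI impI, elim conjE)
  fix s :: "nat \<Rightarrow> real^'d^'d" and l
  assume s: "\<forall>n. s n \<in> {s \<in> psd_mats. psd_sqrt s \<in> C}" and lim: "s \<longlonglongrightarrow> l"
  define r where "r n = psd_sqrt (s n)" for n
  have sp: "s n \<in> psd_mats" for n using s by simp
  have l: "l \<in> psd_mats"
    using closed_psd_mats sp lim closed_sequentially by blast
  obtain B where B: "\<And>n. norm (s n) \<le> B"
    using convergent_imp_bounded[OF lim] by (auto simp: bounded_iff)
  have "norm (r n) \<le> real CARD('d) * sqrt B" for n
  proof (rule norm_symmetric_le)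
    show "transpose (r n) = r n" using psd_sqrt_mem[OF sp] by (simp add: psd_mats_def r_def)
    fix i
    \<comment> \<open>The squared length of a column of the root is a diagonal entry of the matrix
      itself.\<close>
    have "(norm (r n *v axis i 1))\<^sup>2 = s n $ i $ i"
      unfolding r_def norm_psd_sqrt_mult[OF sp]
      by (simp add: inner_axis' matrix_vector_mult_basis column_def)
    also have "\<dots> \<le> norm (s n $ i)" using component_le_norm_cart[of "s n $ i" i] by simp
    also have "\<dots> \<le> norm (s n)" by (rule Finite_Cartesian_Product.norm_nth_le)
    finally show "norm (r n *v axis i 1) \<le> sqrt B" using B[of n] real_le_rsqrt by force
  qed
  then have "bounded (range r)" by (auto simp: bounded_iff)
  then obtain q f where f: "strict_mono f" "(r \<circ> f) \<longlonglongrightarrow> q"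
    using bounded_imp_convergent_subsequence by blast
  have "\<forall>n. (r \<circ> f) n \<in> C" "\<forall>n. (r \<circ> f) n \<in> psd_mats"
    using s psd_sqrt_mem[OF sp] by (auto simp: r_def)
  then have q: "q \<in> C" "q \<in> psd_mats"
    using C closed_psd_mats f(2) closed_sequentially by blast+
  have "continuous_on UNIV (\<lambda>r :: real^'d^'d. r ** r)"
    unfolding matrix_matrix_mult_def by (intro continuous_intros)
  from continuous_on_tendsto_compose[OF this f(2)]
  have "(\<lambda>n. (r \<circ> f) n ** (r \<circ> f) n) \<longlonglongrightarrow> q ** q" by simp
  moreover have "(\<lambda>n. (r \<circ> f) n ** (r \<circ> f) n) = s \<circ> f"
    by (auto simp: r_def psd_sqrt_mult[OF sp])
  ultimately have "q ** q = l"
    using LIMSEQ_unique LIMSEQ_subseq_LIMSEQ[OF lim f(1)] by metis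
  then have "psd_sqrt l = q"
    using psd_sqrt_unique[OF psd_sqrt_mem[OF l] q(2)] psd_sqrt_mult[OF l] by simp
  with q l show "l \<in> {s \<in> psd_mats. psd_sqrt s \<in> C}" by simp
qed

lemma measurable_psd_sqrt:
  fixes Z :: "'w \<Rightarrow> real^'d^'d"
  assumes Z: "Z \<in> borel_measurable M" and psd: "\<And>\<omega>. \<omega> \<in> space M \<Longrightarrow> Z \<omega> \<in> psd_mats"
  shows "(\<lambda>\<omega>. psd_sqrt (Z \<omega>)) \<in> borel_measurable M"
proof (rule borel_measurableI)
  fix S :: "(real^'d^'d) set" assume "open S"
  \<comment> \<open>Within the cone the preimage of an open set is a difference of two closed sets.
    Outside the cone \<open>psd_sqrt\<close> is unspecified, so the test set is cut down to the
    cone.\<close>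
  then have "psd_mats - {s \<in> psd_mats. psd_sqrt s \<in> - S} \<in> sets borel"
    by (intro sets.Diff borel_closed closed_psd_sqrt_vimage closed_psd_mats) (simp add: closed_Compl)
  from measurable_sets[OF Z this]
  have "Z -` (psd_mats - {s \<in> psd_mats. psd_sqrt s \<in> - S}) \<inter> space M \<in> sets M" .
  also have "Z -` (psd_mats - {s \<in> psd_mats. psd_sqrt s \<in> - S}) \<inter> space M
      = (\<lambda>\<omega>. psd_sqrt (Z \<omega>)) -` S \<inter> space M"
    using psd by auto
  finally show "(\<lambda>\<omega>. psd_sqrt (Z \<omega>)) -` S \<inter> space M \<in> sets M" .
qed

section \<open>Basic facts about distributions\<close>

lemma distributionsD:
  assumes "\<mu> \<in> distributions"
  shows "prob_space \<mu>" "sets \<mu> = sets borel" "space \<mu> = UNIV"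
  using assms sets_eq_imp_space_eq[of \<mu> borel] by (auto simp: distributions_def)

lemma distr_in_distributions:
  assumes "prob_space M" "f \<in> borel_measurable M"
  shows "distr M borel f \<in> distributions"
  using assms by (simp add: distributions_def prob_space.prob_space_distr)

lemma cis_measurable [measurable]: "cis \<in> borel_measurable borel"
  by (intro borel_measurable_continuous_onI continuous_intros)

section \<open>Standard Gaussian measure\<close>

definition gauss_density :: "real^'n \<Rightarrow> real" where
  "gauss_density x = (\<Prod>i\<in>UNIV. std_normal_density (x $ i))"

definition gauss :: "(real^'n) measure" where
  "gauss = density lborel (\<lambda>x. ennreal (gauss_density x))"

lemma gauss_density_measurable [measurable]: "gauss_density \<in> borel_measurable borel"
  unfolding gauss_density_def[abs_def] normal_density_def by measurable

lemma gauss_density_pos: "0 < gauss_density x"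
  unfolding gauss_density_def by (intro prod_pos) (simp add: normal_density_pos)

lemma gauss_density_eq:
  fixes x :: "real^'n"
  shows "gauss_density x = (1 / sqrt (2 * pi)) ^ CARD('n) * exp (- (x \<bullet> x) / 2)"
proof -
  have "gauss_density x = (\<Prod>i\<in>UNIV. (1 / sqrt (2 * pi)) * exp (- (x $ i)\<^sup>2 / 2))"
    by (simp add: gauss_density_def normal_density_def)
  also have "\<dots> = (1 / sqrt (2 * pi)) ^ CARD('n) * (\<Prod>i\<in>UNIV. exp (- (x $ i)\<^sup>2 / 2))"
    by (simp only: prod.distrib prod_constant)
  also have "(\<Prod>i\<in>UNIV. exp (- (x $ i)\<^sup>2 / 2)) = exp (\<Sum>i\<in>UNIV. - (x $ i)\<^sup>2 / 2)"
    by (simp add: exp_sum)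
  also have "(\<Sum>i\<in>UNIV. - (x $ i)\<^sup>2 / 2) = - (x \<bullet> x) / 2"
    by (simp add: inner_vec_def power2_eq_square sum_negf sum_divide_distrib)
  finally show ?thesis .
qed

lemma gauss_density_le: "gauss_density (x :: real^'n) \<le> (1 / sqrt (2 * pi)) ^ CARD('n)"
  by (simp add: gauss_density_eq mult_left_le)

text \<open>\<open>lborel\<close> factorizes over the set \<open>Basis\<close>, whereas vectors are
  indexed by coordinates; the choice operator reads the coordinate back from the basis
  vector.\<close>

lemma prod_vec_Basis:
  fixes f :: "'n::finite \<Rightarrow> real^'n \<Rightarrow> 'b::comm_monoid_mult"
  shows "(\<Prod>b\<in>Basis. f (SOME i. b = axis i 1) b) = (\<Prod>i\<in>UNIV. f i (axis i 1))"
proof -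
  have "inj (\<lambda>i::'n. axis i (1::real))" by (auto intro!: injI simp: axis_eq_axis)
  moreover have "(Basis :: (real^'n) set) = range (\<lambda>i. axis i 1)" by (auto simp: Basis_vec_def)
  moreover have "(SOME j. axis i (1::real) = axis j 1) = i" for i :: 'n
    by (rule some_equality) (auto simp: axis_eq_axis)
  ultimately show ?thesis
    using prod.reindex[of "\<lambda>i::'n. axis i (1::real)" UNIV "\<lambda>b. f (SOME i. b = axis i 1) b"]
    by (simp add: o_def)
qed

lemma integral_lborel_vec_prod:
  fixes f :: "'n::finite \<Rightarrow> real \<Rightarrow> complex"
  assumes int: "\<And>i. integrable lborel (f i)"
  shows "(\<integral>x. (\<Prod>i\<in>UNIV. f i (x $ i)) \<partial>(lborel :: (real^'n) measure)) = (\<Prod>i\<in>UNIV. \<integral>t. f i t \<partial>lborel)"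
proof -
  define F where "F b = f (SOME i. b = axis i 1)" for b :: "real^'n"
  have [measurable]: "f i \<in> borel_measurable borel" for i
    using borel_measurable_integrable[OF int] by simp
  have [measurable]: "F b \<in> borel_measurable borel" for b by (simp add: F_def)
  interpret product_sigma_finite "\<lambda>_::real^'n. lborel :: real measure" ..
  have "(\<integral>x. (\<Prod>i\<in>UNIV. f i (x $ i)) \<partial>lborel) = (\<integral>x. (\<Prod>b\<in>Basis. F b (x \<bullet> b)) \<partial>(lborel :: (real^'n) measure))"
    unfolding F_def prod_vec_Basis[of "\<lambda>i b. f i (x \<bullet> b)" for x :: "real^'n"]
    by (simp add: inner_axis)
  also have "\<dots> = (\<integral>x. (\<Prod>b\<in>Basis. F b (x b)) \<partial>(\<Pi>\<^sub>M b\<in>Basis. lborel))"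
    by (subst lborel_eq, subst integral_distr) (auto intro!: Bochner_Integration.integral_cong prod.cong)
  also have "\<dots> = (\<Prod>b\<in>Basis. \<integral>t. F b t \<partial>lborel)"
    by (rule product_integral_prod) (simp_all add: F_def int)
  also have "\<dots> = (\<Prod>i\<in>UNIV. \<integral>t. f i t \<partial>lborel)"
    unfolding F_def by (rule prod_vec_Basis[of "\<lambda>i b. \<integral>t. f i t \<partial>lborel"])
  finally show ?thesis .
qed

lemma nn_integral_lborel_vec_prod:
  fixes f :: "real \<Rightarrow> ennreal"
  assumes [measurable]: "f \<in> borel_measurable borel"
  shows "(\<integral>\<^sup>+x. (\<Prod>i\<in>UNIV. f (x $ i)) \<partial>(lborel :: (real^'n) measure)) = (\<integral>\<^sup>+t. f t \<partial>lborel) ^ CARD('n)"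
proof -
  have "(\<integral>\<^sup>+x. (\<Prod>i\<in>UNIV. f (x $ i)) \<partial>(lborel :: (real^'n) measure)) = (\<integral>\<^sup>+x. (\<Prod>b\<in>Basis. f (x \<bullet> b)) \<partial>(lborel :: (real^'n) measure))"
    unfolding prod_vec_Basis[of "\<lambda>i b. f (x \<bullet> b)" for x :: "real^'n"] by (simp add: inner_axis)
  also have "\<dots> = (\<integral>\<^sup>+t. f t \<partial>lborel) ^ CARD('n)"
    by (subst nn_integral_lborel_prod) simp_all
  finally show ?thesis .
qed

lemma gauss_in_distributions: "(gauss :: (real^'n) measure) \<in> distributions"
proof -
  have "(\<integral>\<^sup>+x. ennreal (std_normal_density x) \<partial>lborel) = 1"
    using prob_space.emeasure_space_1[OF prob_space_normal_density[of 1 0]]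
    by (simp add: emeasure_density)
  moreover have "emeasure (gauss :: (real^'n) measure) (space gauss)
      = (\<integral>\<^sup>+x. (\<Prod>i\<in>UNIV. ennreal (std_normal_density (x $ i))) \<partial>(lborel :: (real^'n) measure))"
    unfolding gauss_def by (simp add: emeasure_density prod_ennreal gauss_density_def)
  ultimately have "emeasure (gauss :: (real^'n) measure) (space gauss) = 1"
    using nn_integral_lborel_vec_prod[of "\<lambda>t. ennreal (std_normal_density t)", where 'n='n] by simp
  then have "prob_space (gauss :: (real^'n) measure)" by (rule prob_spaceI)
  then show ?thesis by (simp add: distributions_def gauss_def)
qed

lemma sets_gauss [measurable_cong, simp]: "sets gauss = sets borel"
  by (simp add: gauss_def)

text \<open>Density and exponential both factorize over the coordinates, which reduces the integral
  to the one-dimensional normal law.\<close>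

lemma charfun_gauss: "charfun gauss z = of_real (exp (- (z \<bullet> z) / 2))"
proof -
  have int: "integrable lborel (\<lambda>t. std_normal_density t *\<^sub>R cis (u * t))"
    and eq: "(\<integral>t. std_normal_density t *\<^sub>R cis (u * t) \<partial>lborel) = of_real (exp (- u\<^sup>2 / 2))" for u :: real
  proof -
    have "integrable std_normal_distribution (\<lambda>t. cis (u * t))"
      using prob_space.integrable_iexp[OF prob_space_normal_density[of 1 0], of "\<lambda>t. u * t"]
      by (simp add: cis_conv_exp)
    then show "integrable lborel (\<lambda>t. std_normal_density t *\<^sub>R cis (u * t))"
      by (subst (asm) integrable_density) (auto simp: normal_density_nonneg)
    have "(\<integral>t. std_normal_density t *\<^sub>R cis (u * t) \<partial>lborel) = char std_normal_distribution u"
      unfolding char_def by (subst integral_density) (auto simp: normal_density_nonneg cis_conv_exp)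
    then show "(\<integral>t. std_normal_density t *\<^sub>R cis (u * t) \<partial>lborel) = of_real (exp (- u\<^sup>2 / 2))"
      by (simp add: char_std_normal_distribution)
  qed
  have "charfun gauss z = (\<integral>x. gauss_density x *\<^sub>R cis (z \<bullet> x) \<partial>lborel)"
    unfolding charfun_def gauss_def by (subst integral_density) (auto simp: gauss_density_pos less_imp_le)
  also have "\<dots> = (\<integral>x. (\<Prod>i\<in>UNIV. std_normal_density (x $ i) *\<^sub>R cis (z $ i * x $ i)) \<partial>lborel)"
    by (intro Bochner_Integration.integral_cong refl)
       (simp add: gauss_density_def scaleR_conv_of_real prod.distrib cis_conv_exp inner_vec_def
          sum_distrib_left exp_sum)
  also have "\<dots> = (\<Prod>i\<in>UNIV. of_real (exp (- (z $ i)\<^sup>2 / 2)))"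
    by (subst integral_lborel_vec_prod[OF int]) (simp add: eq)
  also have "\<dots> = of_real (exp (\<Sum>i\<in>UNIV. - (z $ i)\<^sup>2 / 2))"
    by (simp add: exp_sum)
  also have "(\<Sum>i\<in>UNIV. - (z $ i)\<^sup>2 / 2) = - (z \<bullet> z) / 2"
    by (simp add: inner_vec_def power2_eq_square sum_negf sum_divide_distrib)
  finally show ?thesis .
qed

section \<open>Uniqueness theorem for characteristic functions\<close>

text \<open>The Gaussian is its own Fourier transform up to a constant, so the density of a Gaussian
  smoothing of \<open>\<mu>\<close> is a function of \<open>charfun \<mu>\<close>.\<close>

lemma gauss_smoothing_charfun:
  fixes \<mu> :: "(real^'n) measure"
  assumes \<mu>: "\<mu> \<in> distributions"
  shows "(\<integral>x. complex_of_real (gauss_density (s *\<^sub>R (y - x))) \<partial>\<mu>)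
    = of_real ((1 / sqrt (2 * pi)) ^ CARD('n)) * (\<integral>z. cis (s * (z \<bullet> y)) * charfun \<mu> (- s *\<^sub>R z) \<partial>gauss)"
proof -
  interpret M: prob_space \<mu> using distributionsD[OF \<mu>] by simp
  interpret G: prob_space "gauss :: (real^'n) measure" using distributionsD[OF gauss_in_distributions] by simp
  interpret pair_prob_space \<mu> "gauss :: (real^'n) measure" ..
  note [measurable_cong] = distributionsD(2)[OF \<mu>]
  have "(\<integral>x. complex_of_real (gauss_density (s *\<^sub>R (y - x))) \<partial>\<mu>)
      = (\<integral>x. of_real ((1 / sqrt (2 * pi)) ^ CARD('n)) * charfun gauss (s *\<^sub>R (y - x)) \<partial>\<mu>)"
    by (simp add: gauss_density_eq charfun_gauss)
  also have "\<dots> = of_real ((1 / sqrt (2 * pi)) ^ CARD('n)) * (\<integral>x. charfun gauss (s *\<^sub>R (y - x)) \<partial>\<mu>)"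
    by simp
  also have "(\<integral>x. charfun gauss (s *\<^sub>R (y - x)) \<partial>\<mu>) = (\<integral>x. \<integral>z. cis (s *\<^sub>R (y - x) \<bullet> z) \<partial>gauss \<partial>\<mu>)"
    by (simp add: charfun_def)
  also have "\<dots> = (\<integral>z. \<integral>x. cis (s *\<^sub>R (y - x) \<bullet> z) \<partial>\<mu> \<partial>gauss)"
    by (rule Fubini_integral[symmetric])
       (rule P.integrable_const_bound[where B=1], auto)
  also have "\<dots> = (\<integral>z. cis (s * (z \<bullet> y)) * charfun \<mu> (- s *\<^sub>R z) \<partial>gauss)"
    unfolding charfun_def
    by (simp flip: integral_mult_right_zero add: cis_mult algebra_simps inner_commute)
  finally show ?thesis .
qed

text \<open>Substitution y = x + u / s: for a standard Gaussian u in dimension n, the vector x + u /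
  s has the density s^n g(s (y - x)), where g is \<open>gauss_density\<close>.\<close>

lemma nn_integral_gauss_shift:
  fixes f :: "real^'n \<Rightarrow> ennreal"
  assumes [measurable]: "f \<in> borel_measurable borel" and s: "0 < s"
  shows "(\<integral>\<^sup>+u. f (x + (1 / s) *\<^sub>R u) \<partial>gauss)
    = (\<integral>\<^sup>+y. ennreal (s ^ CARD('n)) * (f y * ennreal (gauss_density (s *\<^sub>R (y - x)))) \<partial>lborel)"
proof -
  have "(\<integral>\<^sup>+u. f (x + (1 / s) *\<^sub>R u) \<partial>gauss)
      = (\<integral>\<^sup>+u. ennreal (gauss_density u) * f (x + (1 / s) *\<^sub>R u) \<partial>lborel)"
    unfolding gauss_def by (subst nn_integral_density) auto
  also have "\<dots> = (\<integral>\<^sup>+u. ennreal (gauss_density u) * f (x + (1 / s) *\<^sub>R u)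
      \<partial>(density (distr lborel borel (\<lambda>y. (- s *\<^sub>R x) + s *\<^sub>R y)) (\<lambda>_. \<bar>s\<bar> ^ DIM(real^'n))))"
    using s by (subst lborel_affine[of s "- s *\<^sub>R x"]) auto
  also have "\<dots> = (\<integral>\<^sup>+y. ennreal (s ^ CARD('n)) * (f y * ennreal (gauss_density (s *\<^sub>R (y - x)))) \<partial>lborel)"
    using s by (subst nn_integral_density; (subst nn_integral_distr)?)
      (auto intro!: nn_integral_cong simp: algebra_simps)
  finally show ?thesis .
qed

text \<open>By Fubini both sides integrate f against the density of the smoothed law, and that
  density depends on the measure through its characteristic function only.\<close>

lemma charfun_eq_imp_smoothing_eq:
  fixes \<mu> \<nu> :: "(real^'n) measure" and f :: "real^'n \<Rightarrow> ennreal"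
  assumes \<mu>: "\<mu> \<in> distributions" and \<nu>: "\<nu> \<in> distributions"
    and eq: "charfun \<mu> = charfun \<nu>"
    and [measurable]: "f \<in> borel_measurable borel" and s: "0 < s"
  shows "(\<integral>\<^sup>+x. \<integral>\<^sup>+u. f (x + (1 / s) *\<^sub>R u) \<partial>gauss \<partial>\<mu>) = (\<integral>\<^sup>+x. \<integral>\<^sup>+u. f (x + (1 / s) *\<^sub>R u) \<partial>gauss \<partial>\<nu>)"
proof -
  \<comment> \<open>The inner integral is a nonnegative real number; writing it as the modulus of a
    complex integral makes \<open>gauss_smoothing_charfun\<close> applicable.\<close>
  have *: "(\<integral>\<^sup>+x. \<integral>\<^sup>+u. f (x + (1 / s) *\<^sub>R u) \<partial>gauss \<partial>\<rho>)
    = (\<integral>\<^sup>+y. ennreal (s ^ CARD('n)) * (f y * ennreal (cmod (\<integral>x. complex_of_real (gauss_density (s *\<^sub>R (y - x))) \<partial>\<rho>))) \<partial>lborel)"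
    if \<rho>: "\<rho> \<in> distributions" for \<rho> :: "(real^'n) measure"
  proof -
    interpret R: prob_space \<rho> using distributionsD[OF \<rho>] by simp
    interpret pair_sigma_finite \<rho> "lborel :: (real^'n) measure" ..
    note [measurable_cong] = distributionsD(2)[OF \<rho>]
    have int: "integrable \<rho> (\<lambda>x. gauss_density (s *\<^sub>R (y - x)))" for y
      by (rule R.integrable_const_bound[where B="(1 / sqrt (2 * pi)) ^ CARD('n)"])
         (auto simp: gauss_density_pos less_imp_le gauss_density_le)
    have "(\<integral>\<^sup>+x. \<integral>\<^sup>+u. f (x + (1 / s) *\<^sub>R u) \<partial>gauss \<partial>\<rho>)
      = (\<integral>\<^sup>+x. (\<integral>\<^sup>+y. ennreal (s ^ CARD('n)) * (f y * ennreal (gauss_density (s *\<^sub>R (y - x)))) \<partial>lborel) \<partial>\<rho>)"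
      using s by (simp add: nn_integral_gauss_shift)
    also have "\<dots> = (\<integral>\<^sup>+y. (\<integral>\<^sup>+x. ennreal (s ^ CARD('n)) * (f y * ennreal (gauss_density (s *\<^sub>R (y - x)))) \<partial>\<rho>) \<partial>lborel)"
      by (rule Fubini'[symmetric]) measurable
    also have "\<dots> = (\<integral>\<^sup>+y. ennreal (s ^ CARD('n)) * (f y * (\<integral>\<^sup>+x. ennreal (gauss_density (s *\<^sub>R (y - x))) \<partial>\<rho>)) \<partial>lborel)"
      by (simp add: nn_integral_cmult)
    also have "(\<lambda>y. \<integral>\<^sup>+x. ennreal (gauss_density (s *\<^sub>R (y - x))) \<partial>\<rho>)
        = (\<lambda>y. ennreal (cmod (\<integral>x. complex_of_real (gauss_density (s *\<^sub>R (y - x))) \<partial>\<rho>)))"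
      by (subst nn_integral_eq_integral[OF int])
         (auto simp: gauss_density_pos less_imp_le integral_nonneg)
    finally show ?thesis .
  qed
  show ?thesis unfolding *[OF \<mu>] *[OF \<nu>] gauss_smoothing_charfun[OF \<mu>] gauss_smoothing_charfun[OF \<nu>] eq ..
qed

text \<open>Smoothing at scale 1 / (n + 1) disappears in the limit because f is bounded and
  continuous. Dominated convergence is applied once, on the product space, instead of to each of the
  nested integrals.\<close>

lemma charfun_eq_imp_nn_integral_eq:
  fixes \<mu> \<nu> :: "(real^'n) measure" and f :: "real^'n \<Rightarrow> real"
  assumes \<mu>: "\<mu> \<in> distributions" and \<nu>: "\<nu> \<in> distributions"
    and eq: "charfun \<mu> = charfun \<nu>"
    and cont: "continuous_on UNIV f" and bd: "\<And>x. f x \<in> {0..1}"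
  shows "(\<integral>\<^sup>+x. f x \<partial>\<mu>) = (\<integral>\<^sup>+x. f x \<partial>\<nu>)"
proof -
  have [measurable]: "f \<in> borel_measurable borel"
    using cont by (rule borel_measurable_continuous_onI)
  have lim: "(\<lambda>n. \<integral>\<^sup>+x. \<integral>\<^sup>+u. f (x + (1 / real (Suc n)) *\<^sub>R u) \<partial>gauss \<partial>\<rho>) \<longlonglongrightarrow> (\<integral>\<^sup>+x. f x \<partial>\<rho>)"
    if \<rho>: "\<rho> \<in> distributions" for \<rho> :: "(real^'n) measure"
  proof -
    interpret R: prob_space \<rho> using distributionsD[OF \<rho>] by simp
    interpret G: prob_space "gauss :: (real^'n) measure" using distributionsD[OF gauss_in_distributions] by simp
    interpret pair_prob_space \<rho> "gauss :: (real^'n) measure" ..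
    note [measurable_cong] = distributionsD(2)[OF \<rho>]
    have "(\<lambda>n. \<integral>\<^sup>+p. f (fst p + (1 / real (Suc n)) *\<^sub>R snd p) \<partial>(\<rho> \<Otimes>\<^sub>M gauss)) \<longlonglongrightarrow> (\<integral>\<^sup>+p. f (fst p) \<partial>(\<rho> \<Otimes>\<^sub>M (gauss :: (real^'n) measure)))"
    proof (rule nn_integral_dominated_convergence[where w="\<lambda>_. 1"])
      show "AE p in \<rho> \<Otimes>\<^sub>M (gauss :: (real^'n) measure). (\<lambda>n. ennreal (f (fst p + (1 / real (Suc n)) *\<^sub>R snd p))) \<longlonglongrightarrow> ennreal (f (fst p))"
      proof (intro AE_I2 tendsto_ennrealI)
        fix p :: "(real^'n) \<times> (real^'n)"
        have "(\<lambda>n. fst p + (1 / real (Suc n)) *\<^sub>R snd p) \<longlonglongrightarrow> fst p + 0 *\<^sub>R snd p"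
          using LIMSEQ_inverse_real_of_nat
          by (intro tendsto_intros) (simp add: inverse_eq_divide)
        then show "(\<lambda>n. f (fst p + (1 / real (Suc n)) *\<^sub>R snd p)) \<longlonglongrightarrow> f (fst p)"
          using continuous_on_tendsto_compose[OF cont] by simp
      qed
    qed (use bd in \<open>auto simp: P.emeasure_space_1\<close>)
    then show ?thesis
      by (subst (asm) (1 2) G.nn_integral_fst[symmetric]) (auto simp: G.emeasure_space_1)
  qed
  have "(\<integral>\<^sup>+x. \<integral>\<^sup>+u. f (x + (1 / real (Suc n)) *\<^sub>R u) \<partial>gauss \<partial>\<mu>) = (\<integral>\<^sup>+x. \<integral>\<^sup>+u. f (x + (1 / real (Suc n)) *\<^sub>R u) \<partial>gauss \<partial>\<nu>)" for n
    by (rule charfun_eq_imp_smoothing_eq[OF \<mu> \<nu> eq, of "\<lambda>x. ennreal (f x)"]) auto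
  then show ?thesis using LIMSEQ_unique[OF lim[OF \<mu>]] lim[OF \<nu>] by simp
qed

text \<open>The closed sets form an intersection-stable generator, and the indicator of a nonempty
  closed set is a pointwise limit of continuous functions with values in [0, 1].\<close>

theorem charfun_unique:
  fixes \<mu> \<nu> :: "(real^'n) measure"
  assumes \<mu>: "\<mu> \<in> distributions" and \<nu>: "\<nu> \<in> distributions"
    and eq: "charfun \<mu> = charfun \<nu>"
  shows "\<mu> = \<nu>"
proof (rule measure_eqI_generator_eq[where E="Collect closed" and \<Omega>=UNIV and A="\<lambda>_. UNIV"])
  show "Int_stable (Collect closed :: (real^'n) set set)" by (auto simp: Int_stable_def)
  show "sets \<mu> = sigma_sets UNIV (Collect closed)" "sets \<nu> = sigma_sets UNIV (Collect closed)"
    using distributionsD(2)[OF \<mu>] distributionsD(2)[OF \<nu>]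
    by (simp_all add: borel_eq_closed sets_measure_of)
  show "emeasure \<mu> UNIV \<noteq> \<infinity>"
    using prob_space.emeasure_space_1[OF distributionsD(1)[OF \<mu>]] distributionsD(3)[OF \<mu>] by simp
  fix C :: "(real^'n) set" assume "C \<in> Collect closed"
  then have C: "closed C" by simp
  show "emeasure \<mu> C = emeasure \<nu> C"
  \<comment> \<open>\<open>infdist\<close> to the empty set is 0 by convention, so the functions
    below would be constantly 1 in that case.\<close>
  proof (cases "C = {}")
    case False
    define f where "f n x = max 0 (1 - real n * infdist x C)" for n x
    have cont: "continuous_on UNIV (f n)" for n
      unfolding f_def by (intro continuous_intros)
    have bd: "f n x \<in> {0..1}" for n x
      by (simp add: f_def infdist_nonneg)
    have lim: "(\<lambda>n. \<integral>\<^sup>+x. f n x \<partial>\<rho>) \<longlonglongrightarrow> emeasure \<rho> C"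
      if \<rho>: "\<rho> \<in> distributions" for \<rho> :: "(real^'n) measure"
    proof -
      interpret R: prob_space \<rho> using distributionsD[OF \<rho>] by simp
      note [measurable_cong] = distributionsD(2)[OF \<rho>]
      have [measurable]: "f n \<in> borel_measurable borel" for n
        using cont by (rule borel_measurable_continuous_onI)
      have [measurable]: "C \<in> sets borel" using C by simp
      have "(\<lambda>n. \<integral>\<^sup>+x. f n x \<partial>\<rho>) \<longlonglongrightarrow> (\<integral>\<^sup>+x. indicator C x \<partial>\<rho>)"
      proof (rule nn_integral_dominated_convergence[where w="\<lambda>_. 1"])
        show "AE x in \<rho>. (\<lambda>n. ennreal (f n x)) \<longlonglongrightarrow> indicator C x"
        proof (rule AE_I2)
          fix x
          show "(\<lambda>n. ennreal (f n x)) \<longlonglongrightarrow> indicator C x"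
          proof (cases "x \<in> C")
            case True
            then have "infdist x C = 0" by simp
            with True show ?thesis by (simp add: f_def)
          next
            case notin: False
            then have "infdist x C > 0"
              using C False infdist_pos_not_in_closed by blast
            then obtain N where N: "real N * infdist x C > 1"
              using reals_Archimedean3 by blast
            have "eventually (\<lambda>n. ennreal (f n x) = indicator C x) sequentially"
              using eventually_ge_at_top[of N]
            proof eventually_elim
              case (elim n)
              then have "real N * infdist x C \<le> real n * infdist x C"
                by (intro mult_right_mono) (auto simp: infdist_nonneg)
              with N notin show ?case by (simp add: f_def)
            qed
            then show ?thesis by (rule tendsto_eventually)
          qed
        qed
      qed (use bd in \<open>auto simp: R.emeasure_space_1\<close>)
      then show ?thesis by (simp add: distributionsD[OF \<rho>])
    qed
    have "(\<integral>\<^sup>+x. f n x \<partial>\<mu>) = (\<integral>\<^sup>+x. f n x \<partial>\<nu>)" for n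
      by (rule charfun_eq_imp_nn_integral_eq[OF \<mu> \<nu> eq cont bd])
    then show ?thesis using LIMSEQ_unique[OF lim[OF \<mu>]] lim[OF \<nu>] by simp
  qed simp
qed auto

section \<open>Convolutions and Laplace transforms\<close>

lemma convolution_in_distributions:
  assumes "\<mu> \<in> distributions" "\<nu> \<in> distributions"
  shows "convolution \<mu> \<nu> \<in> distributions"
proof -
  interpret M: prob_space \<mu> using distributionsD[OF assms(1)] by simp
  interpret N: prob_space \<nu> using distributionsD[OF assms(2)] by simp
  interpret pair_prob_space \<mu> \<nu> ..
  note [measurable_cong] = distributionsD(2)[OF assms(1)] distributionsD(2)[OF assms(2)]
  show ?thesis
    unfolding convolution_def by (intro distr_in_distributions) (unfold_locales, measurable)
qed

lemma return_in_distributions: "return borel x \<in> distributions"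
  by (simp add: distributions_def prob_space_return)

lemma conv_power_in_distributions: "\<nu> \<in> distributions \<Longrightarrow> conv_power \<nu> k \<in> distributions"
  by (induction k) (simp_all add: return_in_distributions convolution_in_distributions)

lemma charfun_convolution:
  assumes "\<mu> \<in> distributions" "\<nu> \<in> distributions"
  shows "charfun (convolution \<mu> \<nu>) z = charfun \<mu> z * charfun \<nu> z"
proof -
  interpret M: prob_space \<mu> using distributionsD[OF assms(1)] by simp
  interpret N: prob_space \<nu> using distributionsD[OF assms(2)] by simp
  interpret pair_prob_space \<mu> \<nu> ..
  note [measurable_cong] = distributionsD(2)[OF assms(1)] distributionsD(2)[OF assms(2)]
  have int: "integrable (\<mu> \<Otimes>\<^sub>M \<nu>) (\<lambda>p. cis (z \<bullet> fst p) * cis (z \<bullet> snd p))"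
    by (rule P.integrable_const_bound[where B=1]) (auto simp: norm_mult)
  have "charfun (convolution \<mu> \<nu>) z = (\<integral>p. cis (z \<bullet> fst p) * cis (z \<bullet> snd p) \<partial>(\<mu> \<Otimes>\<^sub>M \<nu>))"
    unfolding charfun_def convolution_def
    by (subst integral_distr) (auto simp: inner_add_right cis_mult split_beta')
  also have "\<dots> = (\<integral>x. \<integral>y. cis (z \<bullet> x) * cis (z \<bullet> y) \<partial>\<nu> \<partial>\<mu>)"
    using integral_fst'[OF int] by simp
  finally show ?thesis by (simp add: charfun_def)
qed

lemma charfun_return_0: "charfun (return borel 0) z = 1"
  unfolding charfun_def by (subst integral_return) auto

lemma charfun_conv_power: "\<nu> \<in> distributions \<Longrightarrow> charfun (conv_power \<nu> k) z = charfun \<nu> z ^ k"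
  by (induction k) (simp_all add: charfun_return_0 charfun_convolution conv_power_in_distributions)

lemma scaled_in_distributions: "\<mu> \<in> distributions \<Longrightarrow> distr \<mu> borel ((*\<^sub>R) c) \<in> distributions"
  by (intro distr_in_distributions) (auto simp: distributions_def)

lemma charfun_scaled:
  assumes "\<mu> \<in> distributions"
  shows "charfun (distr \<mu> borel ((*\<^sub>R) c)) z = charfun \<mu> (c *\<^sub>R z)"
proof -
  note [measurable_cong] = distributionsD(2)[OF assms]
  show ?thesis unfolding charfun_def by (subst integral_distr) auto
qed

lemma AE_convolution_iff:
  assumes "\<mu> \<in> distributions" "\<nu> \<in> distributions" and [measurable]: "Measurable.pred borel P"
  shows "(AE x in convolution \<mu> \<nu>. P x) \<longleftrightarrow> (AE x in \<mu>. AE y in \<nu>. P (x + y))"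
proof -
  interpret M: prob_space \<mu> using distributionsD[OF assms(1)] by simp
  interpret N: prob_space \<nu> using distributionsD[OF assms(2)] by simp
  interpret pair_prob_space \<mu> \<nu> ..
  note [measurable_cong] = distributionsD(2)[OF assms(1)] distributionsD(2)[OF assms(2)]
  have "(AE x in convolution \<mu> \<nu>. P x) \<longleftrightarrow> (AE p in \<mu> \<Otimes>\<^sub>M \<nu>. P (fst p + snd p))"
    unfolding convolution_def by (subst AE_distr_iff) (auto simp: split_beta')
  also have "\<dots> \<longleftrightarrow> (AE x in \<mu>. AE y in \<nu>. P (x + y))"
    by (rule AE_pair_iff[symmetric]) measurable
  finally show ?thesis .
qed

text \<open>Extended nonnegative values make the product rule for convolutions valid without
  integrability conditions. For a distribution carried by the half-space w . x >= 0 the value is at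
  most 1.\<close>

definition lap :: "(real^'n) measure \<Rightarrow> real^'n \<Rightarrow> ennreal" where
  "lap \<mu> w = (\<integral>\<^sup>+x. ennreal (exp (- (w \<bullet> x))) \<partial>\<mu>)"

lemma lap_convolution:
  assumes "\<mu> \<in> distributions" "\<nu> \<in> distributions"
  shows "lap (convolution \<mu> \<nu>) w = lap \<mu> w * lap \<nu> w"
proof -
  note [measurable_cong] = distributionsD(2)[OF assms(1)] distributionsD(2)[OF assms(2)]
  have "lap (convolution \<mu> \<nu>) w = (\<integral>\<^sup>+x. \<integral>\<^sup>+y. ennreal (exp (- (w \<bullet> (x + y)))) \<partial>\<nu> \<partial>\<mu>)"
    unfolding lap_def using assms
    by (intro nn_integral_convolution) (auto dest: distributionsD prob_space.finite_measure)
  also have "\<dots> = (\<integral>\<^sup>+x. \<integral>\<^sup>+y. ennreal (exp (- (w \<bullet> x))) * ennreal (exp (- (w \<bullet> y))) \<partial>\<nu> \<partial>\<mu>)"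
    by (simp add: inner_add_right flip: ennreal_mult exp_add)
  also have "\<dots> = lap \<mu> w * lap \<nu> w"
    unfolding lap_def by (subst nn_integral_cmult) (auto simp: nn_integral_multc)
  finally show ?thesis .
qed

lemma lap_conv_power: "\<nu> \<in> distributions \<Longrightarrow> lap (conv_power \<nu> k) w = lap \<nu> w ^ k"
  by (induction k) (simp_all add: lap_convolution conv_power_in_distributions,
      simp add: lap_def nn_integral_return)

lemma lap_scaled:
  assumes "\<mu> \<in> distributions"
  shows "lap (distr \<mu> borel ((*\<^sub>R) c)) w = lap \<mu> (c *\<^sub>R w)"
proof -
  note [measurable_cong] = distributionsD(2)[OF assms]
  show ?thesis unfolding lap_def by (subst nn_integral_distr) auto
qed

text \<open>Picks a point that violates P and still satisfies an almost sure property: if there were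
  none, Q would imply P and P would hold almost surely.\<close>

lemma not_AE_witness:
  "\<not> (AE x in M. P x) \<Longrightarrow> AE x in M. Q x \<Longrightarrow> \<exists>x. \<not> P x \<and> Q x"
  by (meson eventually_mono)

section \<open>Convolution factors of distributions on half-spaces\<close>

lemma AE_nonneg_convolution:
  fixes w :: "real^'n"
  assumes "\<mu> \<in> distributions" "\<nu> \<in> distributions" "AE x in \<mu>. 0 \<le> w \<bullet> x" "AE x in \<nu>. 0 \<le> w \<bullet> x"
  shows "AE x in convolution \<mu> \<nu>. 0 \<le> w \<bullet> x"
  unfolding AE_convolution_iff[OF assms(1,2), of "\<lambda>x. 0 \<le> w \<bullet> x", simplified inner_add_right, simplified]
  using assms(3) by eventually_elim (use assms(4) in eventually_elim, simp)

lemma AE_nonneg_conv_power: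
  fixes w :: "real^'n"
  assumes "\<nu> \<in> distributions" "AE x in \<nu>. 0 \<le> w \<bullet> x"
  shows "AE x in conv_power \<nu> k. 0 \<le> w \<bullet> x"
proof (induction k)
  case 0
  show ?case unfolding conv_power.simps by (subst AE_return) auto
next
  case (Suc k)
  then show ?case
    unfolding conv_power.simps by (intro AE_nonneg_convolution conv_power_in_distributions assms)
qed

text \<open>Exponents start at 1 because the zeroth power carries no information on the root. In the
  step, a point x with w . x < 0 and w . (x + y) >= 0 for almost all y puts the next lower power on
  the half-space, so the induction hypothesis applies.\<close>

lemma AE_nonneg_conv_root:
  fixes w :: "real^'n"
  assumes \<nu>: "\<nu> \<in> distributions" and "AE x in conv_power \<nu> (Suc k). 0 \<le> w \<bullet> x"
  shows "AE x in \<nu>. 0 \<le> w \<bullet> x"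
  using assms(2)
proof (induction k)
  case 0
  then have "AE x in \<nu>. AE y in return borel 0. 0 \<le> w \<bullet> (x + y)"
    unfolding conv_power.simps
    by (subst (asm) AE_convolution_iff[OF \<nu> return_in_distributions]) auto
  then show ?case by (subst (asm) AE_return) auto
next
  case (Suc k)
  show ?case
  proof (rule ccontr)
    assume neg: "\<not> ?thesis"
    have "AE x in \<nu>. AE y in conv_power \<nu> (Suc k). 0 \<le> w \<bullet> (x + y)"
      using Suc.prems
      unfolding conv_power.simps(2)[of \<nu> "Suc k"]
      by (subst (asm) AE_convolution_iff[OF \<nu> conv_power_in_distributions[OF \<nu>]]) auto
    then have "\<exists>x. w \<bullet> x < 0 \<and> (AE y in conv_power \<nu> (Suc k). 0 \<le> w \<bullet> (x + y))"
      using not_AE_witness[OF neg] by (simp add: not_le)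
    then obtain x where x: "w \<bullet> x < 0" "AE y in conv_power \<nu> (Suc k). 0 \<le> w \<bullet> (x + y)" by blast
    from x(2) have "AE y in conv_power \<nu> (Suc k). 0 \<le> w \<bullet> y"
      by eventually_elim (use x(1) in \<open>simp add: inner_add_right\<close>)
    then show False using Suc.IH neg by blast
  qed
qed

text \<open>If the factor charged \<open>{w \<bullet> y \<le> - e}\<close>, every essential lower bound \<open>a\<close> of \<open>w \<bullet> x\<close>
  could be improved to \<open>(a + e) / c\<close>.\<close>

lemma AE_nonneg_semi_sd_factor:
  fixes w :: "real^'n"
  assumes \<mu>: "\<mu> \<in> distributions" and \<nu>: "\<nu> \<in> distributions" and c: "0 < c" "c < 1"
    and eq: "\<mu> = convolution \<nu> (distr \<mu> borel ((*\<^sub>R) c))"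
    and nonneg: "AE x in \<mu>. 0 \<le> w \<bullet> x"
  shows "AE x in \<nu>. 0 \<le> w \<bullet> x"
proof (rule ccontr)
  assume neg: "\<not> ?thesis"
  interpret M: prob_space \<mu> using distributionsD[OF \<mu>] by simp
  note [measurable_cong] = distributionsD(2)[OF \<mu>]
  \<comment> \<open>A definite margin e > 0 is charged; otherwise the countably many conditions
    together would give w . y >= 0 almost surely.\<close>
  have "\<exists>n. \<not> (AE y in \<nu>. - inverse (real (Suc n)) < w \<bullet> y)"
  proof (rule ccontr)
    assume "\<not> ?thesis"
    then have "AE y in \<nu>. \<forall>n. - inverse (real (Suc n)) < w \<bullet> y" by (simp add: AE_all_countable)
    then have "AE y in \<nu>. 0 \<le> w \<bullet> y"
    proof eventually_elim
      case (elim y)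
      show ?case
      proof (rule ccontr)
        assume "\<not> ?thesis"
        then obtain n where "inverse (real (Suc n)) < - (w \<bullet> y)"
          using reals_Archimedean[of "- (w \<bullet> y)"] by auto
        then show False using elim[rule_format, of n] by simp
      qed
    qed
    with neg show False by blast
  qed
  then obtain e :: real where e: "e > 0" "\<not> (AE y in \<nu>. - e < w \<bullet> y)"
    by (metis inverse_positive_iff_positive of_nat_0_less_iff zero_less_Suc)
  \<comment> \<open>Only the gain from a to a + e is kept: a + e <= c (w . x) forces w . x > 0,
    after which the factor c < 1 may be dropped.\<close>
  have step: "AE x in \<mu>. a + e \<le> w \<bullet> x" if a: "0 \<le> a" "AE x in \<mu>. a \<le> w \<bullet> x" for a
  proof -
    have "AE x in convolution \<nu> (distr \<mu> borel ((*\<^sub>R) c)). a \<le> w \<bullet> x"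
      using a(2) by (subst eq[symmetric])
    then have "AE y in \<nu>. AE x in distr \<mu> borel ((*\<^sub>R) c). a \<le> w \<bullet> (y + x)"
      by (subst (asm) AE_convolution_iff[OF \<nu> scaled_in_distributions[OF \<mu>]]) auto
    then have "AE y in \<nu>. AE x in \<mu>. a \<le> w \<bullet> (y + c *\<^sub>R x)"
      by (subst (asm) AE_distr_iff) auto
    then have "\<exists>y. w \<bullet> y \<le> - e \<and> (AE x in \<mu>. a \<le> w \<bullet> (y + c *\<^sub>R x))"
      using not_AE_witness[OF e(2)] by (simp add: not_less)
    then obtain y where y: "w \<bullet> y \<le> - e" "AE x in \<mu>. a \<le> w \<bullet> (y + c *\<^sub>R x)" by blast
    from y(2) show ?thesis
    proof eventually_elim
      case (elim x)
      then have *: "a + e \<le> c * (w \<bullet> x)" using y(1) by (simp add: inner_add_right)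
      then have "0 < w \<bullet> x" using a e c by (smt (verit) mult_nonneg_nonpos)
      then have "c * (w \<bullet> x) \<le> w \<bullet> x" using c by simp
      with * show ?case by simp
    qed
  qed
  have "AE x in \<mu>. real n * e \<le> w \<bullet> x" for n
  proof (induction n)
    case (Suc n)
    then show ?case using step[of "real n * e"] e(1) by (simp add: distrib_right add.commute)
  qed (use nonneg in simp)
  then have "AE x in \<mu>. \<forall>n. real n * e \<le> w \<bullet> x" by (simp add: AE_all_countable)
  \<comment> \<open>No real number exceeds all multiples of e, whereas a probability measure is not
    carried by the empty set.\<close>
  then have "AE x in \<mu>. False"
  proof eventually_elim
    case (elim x)
    then show ?case using reals_Archimedean3[OF e(1), rule_format, of "w \<bullet> x"] by (meson not_less)
  qed
  then show False using M.AE_False by simp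
qed

section \<open>Gaussian mixtures\<close>

text \<open>Inverts \<open>lower_tri\<close> on symmetric matrices: max and min send (i, j) and (j,
  i) to the same stored position. It is total, so membership in the cone can be stated for arbitrary
  coordinate vectors.\<close>

definition sym_of :: "real^(('d::{finite,linorder}) ltri) \<Rightarrow> real^('d::{finite,linorder})^('d::{finite,linorder})" where
  "sym_of x = (\<chi> i j. x $ Abs_ltri (max i j, min i j))"

text \<open>Represents the functional s |-> z . s z in lower-triangle coordinates: its entries are
  z_j^2 on the diagonal and 2 z_j z_k off it, since an off-diagonal position fills two entries of
  the matrix.\<close>

definition quad_vec :: "real^('d::{finite,linorder}) \<Rightarrow> real^(('d::{finite,linorder}) ltri)" where
  "quad_vec z = (\<chi> p. z \<bullet> (sym_of (axis p 1) *v z))"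

lemma sym_of_lower_tri:
  assumes "transpose s = s"
  shows "sym_of (lower_tri s) = s"
proof -
  have "s $ i $ j = s $ j $ i" for i j
    using assms by (metis transpose_def vec_lambda_beta)
  then show ?thesis
    by (auto simp: lower_tri_def sym_of_def vec_eq_iff Abs_ltri_inverse max_def min_def)
qed

lemma transpose_sym_of: "transpose (sym_of x) = sym_of x"
  by (simp add: transpose_def sym_of_def vec_eq_iff max.commute min.commute)

lemma continuous_sym_of: "continuous_on S sym_of"
  unfolding sym_of_def by (intro continuous_intros)

lemma sym_of_measurable [measurable]: "sym_of \<in> borel_measurable borel"
  by (intro borel_measurable_continuous_onI continuous_sym_of)

lemma lower_tri_measurable [measurable]: "lower_tri \<in> borel_measurable borel"
  unfolding lower_tri_def by (intro borel_measurable_continuous_onI continuous_intros)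

lemma inner_quad_vec: "quad_vec z \<bullet> x = z \<bullet> (sym_of x *v z)"
proof -
  have "linear (\<lambda>x. z \<bullet> (sym_of x *v z))"
    by (rule linearI)
      (simp_all add: sym_of_def inner_vec_def matrix_vector_mult_def algebra_simps sum.distrib sum_distrib_left)
  then interpret l: linear "\<lambda>x. z \<bullet> (sym_of x *v z)" .
  have "z \<bullet> (sym_of x *v z) = (\<Sum>b\<in>Basis. (x \<bullet> b) *\<^sub>R (z \<bullet> (sym_of b *v z)))"
    using arg_cong[OF euclidean_representation[of x], of "\<lambda>x. z \<bullet> (sym_of x *v z)"]
    by (simp add: l.sum l.scale)
  also have "\<dots> = (\<Sum>b\<in>(\<lambda>p. axis p (1::real)) ` UNIV. (x \<bullet> b) *\<^sub>R (z \<bullet> (sym_of b *v z)))"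
    by (intro sum.cong) (auto simp: Basis_vec_def)
  also have "\<dots> = (\<Sum>p\<in>UNIV. (x $ p) * (z \<bullet> (sym_of (axis p 1) *v z)))"
    by (subst sum.reindex) (auto intro!: injI simp: axis_eq_axis inner_axis)
  finally show ?thesis by (simp add: quad_vec_def inner_vec_def mult.commute)
qed

lemma quad_vec_scaleR: "quad_vec (c *\<^sub>R z) = c\<^sup>2 *\<^sub>R quad_vec z"
  by (simp add: quad_vec_def vec_eq_iff matrix_vector_mult_scaleR power2_eq_square)

lemma continuous_quad_vec: "continuous_on S quad_vec"
  unfolding quad_vec_def matrix_vector_mult_def inner_vec_def by (intro continuous_intros)

definition on_cone :: "(real^('d::{finite,linorder} ltri)) measure \<Rightarrow> bool" where
  "on_cone \<mu> \<longleftrightarrow> (AE x in \<mu>. sym_of x \<in> psd_mats)"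

text \<open>Splits the cone into half-spaces, to which the factor lemmas apply one at a time. The
  exceptional null sets depend on z, so they are combined over a countable dense set, and continuity
  in z gives the rest.\<close>

lemma on_cone_iff: "on_cone \<mu> \<longleftrightarrow> (\<forall>z. AE x in \<mu>. 0 \<le> quad_vec z \<bullet> x)"
proof
  assume "on_cone \<mu>"
  then show "\<forall>z. AE x in \<mu>. 0 \<le> quad_vec z \<bullet> x"
    unfolding on_cone_def
    by (intro allI) (elim eventually_mono, simp add: inner_quad_vec psd_mats_def)
next
  assume AE: "\<forall>z. AE x in \<mu>. 0 \<le> quad_vec z \<bullet> x"
  obtain D :: "(real, 'a) vec set" where D: "countable D" "closure D = UNIV"
    using separable[of "UNIV :: (real, 'a) vec set"] by (metis top.extremum_uniqueI)
  have "AE x in \<mu>. \<forall>z\<in>D. 0 \<le> quad_vec z \<bullet> x"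
    using AE D(1) by (subst AE_ball_countable) auto
  then show "on_cone \<mu>"
    unfolding on_cone_def
  proof eventually_elim
    case (elim x)
    have "closed {z. 0 \<le> quad_vec z \<bullet> x}"
      by (intro closed_Collect_le continuous_intros continuous_quad_vec)
    then have "closure D \<subseteq> {z. 0 \<le> quad_vec z \<bullet> x}"
      using elim by (intro closure_minimal) auto
    then show ?case using D by (auto simp: psd_mats_def transpose_sym_of inner_quad_vec)
  qed
qed

text \<open>The value 0 off the cone makes the root a Borel function on the whole coordinate
  space.\<close>

definition cone_root :: "real^(('d::{finite,linorder}) ltri) \<Rightarrow> real^('d::{finite,linorder})^('d::{finite,linorder})" where
  "cone_root x = (if sym_of x \<in> psd_mats then psd_sqrt (sym_of x) else 0)"

lemma cone_root_measurable [measurable]: "cone_root \<in> borel_measurable borel"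
proof -
  have "{x. sym_of x \<in> psd_mats} \<in> sets borel"
    using measurable_sets[OF sym_of_measurable borel_closed[OF closed_psd_mats]] by (simp add: vimage_def)
  then show ?thesis
    unfolding cone_root_def[abs_def]
    by (subst measurable_If_restrict_space_iff)
       (auto intro!: measurable_psd_sqrt simp: space_restrict_space measurable_restrict_space1)
qed

section \<open>The mixture and its characteristic function\<close>

lemma matrix_vector_mult_measurable [measurable (raw)]:
  fixes f :: "'a \<Rightarrow> real^'n^'m"
  assumes "f \<in> borel_measurable M" "g \<in> borel_measurable M"
  shows "(\<lambda>x. f x *v g x) \<in> borel_measurable M"
proof -
  have "continuous_on UNIV (\<lambda>p :: (real^'n^'m) \<times> (real^'n). fst p *v snd p)"
    unfolding matrix_vector_mult_def by (intro continuous_intros)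
  from borel_measurable_continuous_Pair[OF assms] this show ?thesis by auto
qed

definition mix :: "(real^(('d::{finite,linorder}) ltri)) measure \<Rightarrow> (real^('d::{finite,linorder})) measure" where
  "mix \<mu> = distr (\<mu> \<Otimes>\<^sub>M gauss) borel (\<lambda>(x, g). cone_root x *v g)"

lemma mix_in_distributions:
  fixes \<mu> :: "(real^('d::{finite,linorder} ltri)) measure"
  assumes "\<mu> \<in> distributions"
  shows "mix \<mu> \<in> distributions"
proof -
  interpret M: prob_space \<mu> using distributionsD[OF assms(1)] by simp
  interpret G: prob_space "gauss :: ((real, 'd) vec) measure" using distributionsD[OF gauss_in_distributions] by simp
  interpret pair_prob_space \<mu> "gauss :: ((real, 'd) vec) measure" ..
  note [measurable_cong] = distributionsD(2)[OF assms(1)]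
  show ?thesis
    unfolding mix_def by (intro distr_in_distributions) (unfold_locales, measurable)
qed

text \<open>For fixed x in the cone with root r, symmetry moves r to z, and the Gaussian integral is
  exp (- |r z|^2 / 2) with |r z|^2 = z . x z. Integrating over x leaves a Laplace transform.\<close>

lemma charfun_mix:
  fixes \<mu> :: "(real^('d::{finite,linorder} ltri)) measure"
  assumes \<mu>: "\<mu> \<in> distributions" and cone: "on_cone \<mu>"
  shows "charfun (mix \<mu>) z = of_real (enn2real (lap \<mu> ((1/2) *\<^sub>R quad_vec z)))"
proof -
  interpret M: prob_space \<mu> using distributionsD[OF assms(1)] by simp
  interpret G: prob_space "gauss :: ((real, 'd) vec) measure" using distributionsD[OF gauss_in_distributions] by simp
  interpret pair_prob_space \<mu> "gauss :: ((real, 'd) vec) measure" ..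
  note [measurable_cong] = distributionsD(2)[OF assms(1)]
  have int: "integrable (\<mu> \<Otimes>\<^sub>M gauss) (\<lambda>p. cis (z \<bullet> (cone_root (fst p) *v snd p)))"
    by (rule P.integrable_const_bound[where B=1]) auto
  have "charfun (mix \<mu>) z = (\<integral>p. cis (z \<bullet> (cone_root (fst p) *v snd p)) \<partial>(\<mu> \<Otimes>\<^sub>M gauss))"
    unfolding charfun_def mix_def by (subst integral_distr) (auto simp: split_beta')
  also have "\<dots> = (\<integral>x. \<integral>g. cis (z \<bullet> (cone_root x *v g)) \<partial>gauss \<partial>\<mu>)"
    using integral_fst'[OF int] by simp
  also have "\<dots> = (\<integral>x. of_real (exp (- ((1/2) *\<^sub>R quad_vec z \<bullet> x))) \<partial>\<mu>)"
  proof (rule integral_cong_AE)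
    show "AE x in \<mu>. (\<integral>g. cis (z \<bullet> (cone_root x *v g)) \<partial>gauss) = of_real (exp (- ((1/2) *\<^sub>R quad_vec z \<bullet> x)))"
      using cone unfolding on_cone_def
    proof eventually_elim
      case (elim x)
      have "transpose (cone_root x) = cone_root x"
        using psd_sqrt_mem[OF elim] elim by (simp add: cone_root_def psd_mats_def)
      then have "(\<integral>g. cis (z \<bullet> (cone_root x *v g)) \<partial>gauss) = charfun gauss (cone_root x *v z)"
        by (simp add: charfun_def symmetric_dot)
      also have "\<dots> = of_real (exp (- ((norm (cone_root x *v z))\<^sup>2) / 2))"
        by (simp add: charfun_gauss power2_norm_eq_inner)
      also have "(norm (cone_root x *v z))\<^sup>2 = quad_vec z \<bullet> x"
        using elim by (simp add: cone_root_def norm_psd_sqrt_mult inner_quad_vec)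
      finally show ?case by simp
    qed
  qed measurable
  also have "\<dots> = of_real (\<integral>x. exp (- ((1/2) *\<^sub>R quad_vec z \<bullet> x)) \<partial>\<mu>)" by simp
  also have "(\<integral>x. exp (- ((1/2) *\<^sub>R quad_vec z \<bullet> x)) \<partial>\<mu>) = enn2real (lap \<mu> ((1/2) *\<^sub>R quad_vec z))"
    unfolding lap_def by (rule integral_eq_nn_integral) auto
  finally show ?thesis .
qed

section \<open>Transfer of infinite divisibility and of the classes L_m to mixtures\<close>

lemma enn2real_power: "enn2real (x ^ k) = enn2real x ^ k"
  by (induction k) (simp_all add: enn2real_mult)

text \<open>The mixture of a k-th root of \<open>\<mu>\<close> is a k-th root of the mixture: the
  root is again carried by the cone, so both characteristic functions are Laplace transforms and the
  power rule carries over.\<close>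

lemma inf_divisible_mix:
  fixes \<mu> :: "(real^('d::{finite,linorder} ltri)) measure"
  assumes \<mu>: "\<mu> \<in> inf_divisible" and cone: "on_cone \<mu>"
  shows "mix \<mu> \<in> inf_divisible"
  unfolding inf_divisible_def
proof (intro CollectI conjI allI impI)
  have D: "\<mu> \<in> distributions" using \<mu> by (simp add: inf_divisible_def)
  then show "mix \<mu> \<in> distributions" by (rule mix_in_distributions)
  fix k :: nat assume k: "1 \<le> k"
  then obtain \<nu> where \<nu>: "\<nu> \<in> distributions" "\<mu> = conv_power \<nu> k"
    using \<mu> unfolding inf_divisible_def by blast
  have "on_cone \<nu>"
    unfolding on_cone_iff
  proof
    fix z
    have "AE x in conv_power \<nu> (Suc (k - 1)). 0 \<le> quad_vec z \<bullet> x"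
      using cone k unfolding on_cone_iff \<nu>(2) by (metis Suc_diff_le diff_Suc_1 Suc_eq_plus1_left le_add_diff_inverse plus_1_eq_Suc)
    then show "AE x in \<nu>. 0 \<le> quad_vec z \<bullet> x" by (rule AE_nonneg_conv_root[OF \<nu>(1)])
  qed
  then have "charfun (mix \<mu>) = charfun (conv_power (mix \<nu>) k)"
    by (simp add: fun_eq_iff charfun_conv_power mix_in_distributions charfun_mix \<nu> D cone[unfolded \<nu>(2)]
        conv_power_in_distributions lap_conv_power enn2real_power)
  then show "\<exists>\<nu>\<in>distributions. mix \<mu> = conv_power \<nu> k"
    by (intro bexI[of _ "mix \<nu>"] charfun_unique mix_in_distributions conv_power_in_distributions \<nu>(1) D)
qed

text \<open>The identity of characteristic functions is first turned into an identity of measures.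
  This yields both the support of \<open>\<mu>'\<close> and the factorization of Laplace transforms.
  The parameter becomes sqrt c because \<open>quad_vec\<close> is quadratic.\<close>

lemma semi_sd_factor_mix:
  fixes \<mu> :: "(real^('d::{finite,linorder} ltri)) measure"
  assumes \<mu>: "\<mu> \<in> distributions" and cone: "on_cone \<mu>" and c: "0 < c" "c < 1"
    and fac: "semi_sd_factor c \<mu> \<mu>'"
  shows "on_cone \<mu>'" and "semi_sd_factor (sqrt c) (mix \<mu>) (mix \<mu>')"
proof -
  have \<mu>': "\<mu>' \<in> distributions" and id: "\<mu>' \<in> inf_divisible"
    and cf: "\<And>z. charfun \<mu> z = charfun \<mu> (c *\<^sub>R z) * charfun \<mu>' z"
    using fac unfolding semi_sd_factor_def inf_divisible_def by blast+
  have eq: "\<mu> = convolution \<mu>' (distr \<mu> borel ((*\<^sub>R) c))"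
  proof (intro charfun_unique ext \<mu> convolution_in_distributions \<mu>' scaled_in_distributions)
    fix z
    show "charfun \<mu> z = charfun (convolution \<mu>' (distr \<mu> borel ((*\<^sub>R) c))) z"
      unfolding charfun_convolution[OF \<mu>' scaled_in_distributions[OF \<mu>]] charfun_scaled[OF \<mu>]
      using cf[of z] by (simp only: mult.commute)
  qed
  show cone': "on_cone \<mu>'"
    using AE_nonneg_semi_sd_factor[OF \<mu> \<mu>' c eq] cone by (simp add: on_cone_iff)
  have "lap \<mu> w = lap \<mu> (c *\<^sub>R w) * lap \<mu>' w" for w
    unfolding lap_scaled[OF \<mu>, symmetric]
    using lap_convolution[OF \<mu>' scaled_in_distributions[OF \<mu>], of c w, folded eq]
    by (simp only: mult.commute)
  then have lap: "lap \<mu> ((1/2) *\<^sub>R quad_vec z) = lap \<mu> ((1/2) *\<^sub>R c *\<^sub>R quad_vec z) * lap \<mu>' ((1/2) *\<^sub>R quad_vec z)" for z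
    by (metis scaleR_left_commute)
  have "charfun (mix \<mu>) z = charfun (mix \<mu>) (sqrt c *\<^sub>R z) * charfun (mix \<mu>') z" for z
  proof -
    have "quad_vec (sqrt c *\<^sub>R z) = c *\<^sub>R quad_vec z" using c by (simp add: quad_vec_scaleR)
    then show ?thesis
      unfolding charfun_mix[OF \<mu> cone] charfun_mix[OF \<mu>' cone'] by (subst lap) (simp add: enn2real_mult)
  qed
  then show "semi_sd_factor (sqrt c) (mix \<mu>) (mix \<mu>')"
    unfolding semi_sd_factor_def using inf_divisible_mix[OF id cone'] by blast
qed

text \<open>The induction runs over all \<open>\<mu>\<close> on the cone; it proceeds because the
  factor \<open>\<mu>'\<close> stays on the cone.\<close>

lemma L_fin_mix:
  assumes "0 < c" "c < 1" "on_cone \<mu>" "\<mu> \<in> L_fin m c"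
  shows "mix \<mu> \<in> L_fin m (sqrt c)"
  using assms(3,4)
proof (induction m arbitrary: \<mu>)
  case 0
  then show ?case
    using semi_sd_factor_mix(2)[OF _ _ assms(1,2)] mix_in_distributions by fastforce
next
  case (Suc m)
  then obtain \<mu>' where \<mu>': "semi_sd_factor c \<mu> \<mu>'" "\<mu>' \<in> L_fin m c" and D: "\<mu> \<in> distributions" by auto
  have "mix \<mu>' \<in> L_fin m (sqrt c)"
    using Suc.IH[OF semi_sd_factor_mix(1)[OF D Suc.prems(1) assms(1,2) \<mu>'(1)] \<mu>'(2)] .
  with semi_sd_factor_mix(2)[OF D Suc.prems(1) assms(1,2) \<mu>'(1)] mix_in_distributions[OF D]
  show ?case by auto
qed

lemma L_class_mix:
  assumes "0 < c" "c < 1" "on_cone \<mu>" "\<mu> \<in> L_class m c"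
  shows "mix \<mu> \<in> L_class m (sqrt c)"
  using assms L_fin_mix[OF assms(1,2,3)] by (auto simp: L_class_def split: enat.splits)

section \<open>Distributions of type multG as mixtures\<close>

lemma multG_repr_eq_mix:
  fixes M :: "'w measure" and \<sigma> :: "(real^('d :: {finite, linorder})) measure"
  assumes "multG_repr M X Z \<sigma>"
  shows "\<sigma> = mix (tri_law M Z)" and "on_cone (tri_law M Z)"
proof -
  have M: "prob_space M" and X: "std_gaussian M X" and Z[measurable]: "Z \<in> borel_measurable M"
    and psd: "\<And>\<omega>. \<omega> \<in> space M \<Longrightarrow> Z \<omega> \<in> psd_mats" and ind: "indep_vec_mat M X Z"
    and \<sigma>: "\<sigma> = distr M borel (\<lambda>\<omega>. psd_sqrt (Z \<omega>) *v X \<omega>)"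
    using assms by (auto simp: multG_repr_def)
  interpret prob_space M by fact
  have Xm[measurable]: "X \<in> borel_measurable M"
    using X unfolding std_gaussian_def by (auto dest: distributed_measurable)
  have X_law: "distr M borel X = gauss"
    using X distributed_distr_eq_density[of M lborel X]
    by (simp add: std_gaussian_def gauss_def gauss_density_def cong: distr_cong)
  have sym: "sym_of (lower_tri (Z \<omega>)) = Z \<omega>" if "\<omega> \<in> space M" for \<omega>
    using psd[OF that] by (simp add: psd_mats_def sym_of_lower_tri)
  then have root: "cone_root (lower_tri (Z \<omega>)) = psd_sqrt (Z \<omega>)" if "\<omega> \<in> space M" for \<omega>
    using psd that by (simp add: cone_root_def)
  interpret G: prob_space "gauss :: ((real, 'd) vec) measure" using distributionsD[OF gauss_in_distributions] by simp
  interpret T: prob_space "tri_law M Z" unfolding tri_law_def by (rule prob_space_distr) measurable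
  \<comment> \<open>Independence enters here: the joint law is compared with the product measure on
    rectangles.\<close>
  have joint: "tri_law M Z \<Otimes>\<^sub>M gauss = distr M (borel \<Otimes>\<^sub>M borel) (\<lambda>\<omega>. (lower_tri (Z \<omega>), X \<omega>))"
  proof (rule pair_measure_eqI)
    show "sigma_finite_measure (tri_law M Z)" "sigma_finite_measure (gauss :: ((real, 'd) vec) measure)" ..
    show "sets (tri_law M Z \<Otimes>\<^sub>M gauss) = sets (distr M (borel \<Otimes>\<^sub>M borel) (\<lambda>\<omega>. (lower_tri (Z \<omega>), X \<omega>)))"
      by (simp add: tri_law_def cong: sets_pair_measure_cong)
    fix A B assume "A \<in> sets (tri_law M Z)" and "B \<in> sets (gauss :: ((real, 'd) vec) measure)"
    then have A[measurable]: "A \<in> sets borel" and B[measurable]: "B \<in> sets borel" by (auto simp: tri_law_def)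
    \<comment> \<open>Through this preimage, a condition on the lower triangle becomes an event of
      the sigma-algebra generated by Z.\<close>
    have lA: "lower_tri -` A \<in> sets borel"
      using measurable_sets[OF lower_tri_measurable A] by simp
    have "prob ((X -` B \<inter> space M) \<inter> (Z -` (lower_tri -` A) \<inter> space M))
        = prob (X -` B \<inter> space M) * prob (Z -` (lower_tri -` A) \<inter> space M)"
      by (rule indep_setD[OF ind[unfolded indep_vec_mat_def]]) (use B lA in blast)+
    then have "emeasure M ((\<lambda>\<omega>. (lower_tri (Z \<omega>), X \<omega>)) -` (A \<times> B) \<inter> space M)
        = emeasure M ((\<lambda>\<omega>. lower_tri (Z \<omega>)) -` A \<inter> space M) * emeasure M (X -` B \<inter> space M)"
      by (simp add: emeasure_eq_measure ennreal_mult[symmetric] mult.commute vimage_def Int_def conj_ac)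
    then show "emeasure (tri_law M Z) A * emeasure gauss B
        = emeasure (distr M (borel \<Otimes>\<^sub>M borel) (\<lambda>\<omega>. (lower_tri (Z \<omega>), X \<omega>))) (A \<times> B)"
      unfolding X_law[symmetric] tri_law_def by (simp add: emeasure_distr)
  qed
  show "\<sigma> = mix (tri_law M Z)"
    unfolding mix_def joint \<sigma>
    by (subst distr_distr) (auto intro!: distr_cong simp: root)
  have "{x \<in> space borel. sym_of x \<in> psd_mats} \<in> sets borel"
    using measurable_sets[OF sym_of_measurable borel_closed[OF closed_psd_mats]] by (simp add: vimage_def)
  then show "on_cone (tri_law M Z)"
    unfolding on_cone_def tri_law_def by (subst AE_distr_iff) (auto simp: sym psd)
qed

section \<open>Characteristic functions of infinitely divisible distributions\<close>

lemma charfun_0: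
  assumes "\<mu> \<in> distributions"
  shows "charfun \<mu> 0 = 1"
  using prob_space.prob_space[OF distributionsD(1)[OF assms]] by (simp add: charfun_def)

lemma continuous_charfun:
  assumes \<mu>: "\<mu> \<in> distributions"
  shows "continuous_on UNIV (charfun \<mu>)"
proof -
  interpret M: prob_space \<mu> using distributionsD[OF \<mu>] by simp
  note [measurable_cong] = distributionsD(2)[OF \<mu>]
  have "(\<lambda>n. charfun \<mu> (s n)) \<longlonglongrightarrow> charfun \<mu> l" if s: "s \<longlonglongrightarrow> l" for s l
    unfolding charfun_def
  proof (rule integral_dominated_convergence[where w="\<lambda>_. 1"])
    have "isCont cis u" for u
      using continuous_on_cis[OF continuous_on_id, of UNIV] by (simp add: continuous_on_eq_continuous_at)
    then show "AE x in \<mu>. (\<lambda>n. cis (s n \<bullet> x)) \<longlonglongrightarrow> cis (l \<bullet> x)"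
      by (intro AE_I2 isCont_tendsto_compose[where g=cis] tendsto_intros s)
  qed auto
  then show ?thesis by (auto simp: continuous_on_sequentially o_def)
qed

text \<open>The inequality \<open>1 - cos 2\<theta> \<le> 4 (1 - cos \<theta>)\<close>, integrated against the symmetrization of \<open>\<mu>\<close>.\<close>

lemma charfun_doubling:
  fixes \<mu> :: "(real^'n) measure"
  assumes \<mu>: "\<mu> \<in> distributions"
  shows "1 - (cmod (charfun \<mu> (2 *\<^sub>R z)))\<^sup>2 \<le> 4 * (1 - (cmod (charfun \<mu> z))\<^sup>2)"
proof -
  define \<eta> where "\<eta> = convolution \<mu> (distr \<mu> borel ((*\<^sub>R) (- 1)))"
  have \<eta>: "\<eta> \<in> distributions"
    unfolding \<eta>_def by (intro convolution_in_distributions scaled_in_distributions \<mu>)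
  interpret E: prob_space \<eta> using distributionsD[OF \<eta>] by simp
  note [measurable_cong] = distributionsD(2)[OF \<eta>]
  have int: "integrable \<eta> (\<lambda>x. cis (u \<bullet> x))" for u
    by (rule E.integrable_const_bound[where B=1]) auto
  have cos: "(cmod (charfun \<mu> u))\<^sup>2 = (\<integral>x. cos (u \<bullet> x) \<partial>\<eta>)" for u
  proof -
    have "cnj (charfun \<mu> u) = charfun \<mu> (- u)"
      using Bochner_Integration.integral_cnj[of \<mu> "\<lambda>x. cis (u \<bullet> x)"] by (simp add: charfun_def cis_cnj)
    then have "charfun \<eta> u = of_real ((cmod (charfun \<mu> u))\<^sup>2)"
      unfolding \<eta>_def complex_norm_square
      by (simp add: charfun_convolution charfun_scaled scaled_in_distributions \<mu>)
    then have "(cmod (charfun \<mu> u))\<^sup>2 = Re (charfun \<eta> u)" by simp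
    also have "\<dots> = (\<integral>x. cos (u \<bullet> x) \<partial>\<eta>)"
      unfolding charfun_def using integral_Re[OF int[of u]] by simp
    finally show ?thesis .
  qed
  have intc: "integrable \<eta> (\<lambda>x. cos (u \<bullet> x))" for u
    by (rule E.integrable_const_bound[where B=1]) auto
  have "(\<integral>x. 1 - cos (2 *\<^sub>R z \<bullet> x) \<partial>\<eta>) \<le> (\<integral>x. 4 * (1 - cos (z \<bullet> x)) \<partial>\<eta>)"
  proof (rule integral_mono)
    fix x
    define v where "v = cos (z \<bullet> x)"
    \<comment> \<open>With v = cos (z . x), the right side minus the left side is 2 (1 -
      v)^2.\<close>
    have "cos (2 *\<^sub>R z \<bullet> x) = 2 * v\<^sup>2 - 1" by (simp add: cos_double_cos v_def)
    moreover have "0 \<le> 2 * (1 - v)\<^sup>2" by simp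
    ultimately show "1 - cos (2 *\<^sub>R z \<bullet> x) \<le> 4 * (1 - cos (z \<bullet> x))"
      by (simp add: power2_eq_square algebra_simps flip: v_def)
  qed (use intc in \<open>simp_all del: inner_scaleR_left\<close>)
  then show ?thesis using intc by (simp add: cos E.prob_space del: inner_scaleR_left)
qed

lemma inf_divisible_rootE:
  assumes "\<mu> \<in> inf_divisible"
  obtains \<nu> where "\<nu> \<in> distributions" "\<mu> = conv_power \<nu> (Suc k)"
proof -
  have "1 \<le> Suc k" by simp
  then show ?thesis using assms that unfolding inf_divisible_def by blast
qed

text \<open>A zero at 2 u is a zero of every root there, so doubling bounds the squared modulus of
  each root at u by 3/4; raising this to arbitrarily high powers gives a zero at u. Hence
  nonvanishing passes from u to 2 u, and it spreads from a neighbourhood of 0 to all z.\<close>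

lemma inf_divisible_charfun_nonzero:
  fixes \<mu> :: "(real^'n) measure"
  assumes \<mu>: "\<mu> \<in> inf_divisible"
  shows "charfun \<mu> z \<noteq> 0"
proof -
  have D: "\<mu> \<in> distributions" using \<mu> by (simp add: inf_divisible_def)
  have double: "charfun \<mu> (2 *\<^sub>R u) \<noteq> 0" if u: "charfun \<mu> u \<noteq> 0" for u
  proof
    assume 0: "charfun \<mu> (2 *\<^sub>R u) = 0"
    have "(cmod (charfun \<mu> u))\<^sup>2 \<le> (3/4) ^ Suc k" for k
    proof -
      obtain \<nu> where \<nu>: "\<nu> \<in> distributions" "\<mu> = conv_power \<nu> (Suc k)"
        using inf_divisible_rootE[OF \<mu>] by blast
      have pow: "charfun \<mu> v = charfun \<nu> v ^ Suc k" for v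
        unfolding \<nu>(2) by (rule charfun_conv_power[OF \<nu>(1)])
      have "charfun \<nu> (2 *\<^sub>R u) = 0" using 0 pow by (metis power_eq_0_iff)
      then have "(cmod (charfun \<nu> u))\<^sup>2 \<le> 3/4" using charfun_doubling[OF \<nu>(1), of u] by simp
      then have "((cmod (charfun \<nu> u))\<^sup>2) ^ Suc k \<le> (3/4) ^ Suc k" by (intro power_mono) auto
      then show ?thesis by (simp only: pow norm_power power_mult[symmetric] mult.commute)
    qed
    moreover have "(\<lambda>k. (3/4 :: real) ^ Suc k) \<longlonglongrightarrow> 0"
      by (intro LIMSEQ_Suc LIMSEQ_realpow_zero) auto
    ultimately have "(cmod (charfun \<mu> u))\<^sup>2 \<le> 0"
      by (intro LIMSEQ_le_const[where X="\<lambda>k. (3/4 :: real) ^ Suc k"]) blast+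
    with u show False by simp
  qed
  have "(\<lambda>n. (1/2) ^ n *\<^sub>R z) \<longlonglongrightarrow> 0 *\<^sub>R z"
    by (intro tendsto_intros LIMSEQ_realpow_zero) auto
  then have "(\<lambda>n. charfun \<mu> ((1/2) ^ n *\<^sub>R z)) \<longlonglongrightarrow> charfun \<mu> 0"
    using continuous_on_tendsto_compose[OF continuous_charfun[OF D]] by simp
  then have "eventually (\<lambda>n. charfun \<mu> ((1/2) ^ n *\<^sub>R z) \<noteq> 0) sequentially"
    using tendsto_imp_eventually_ne[of _ "1::complex" sequentially 0] by (simp add: charfun_0[OF D])
  then obtain n where n: "charfun \<mu> ((1/2) ^ n *\<^sub>R z) \<noteq> 0" by (auto simp: eventually_sequentially)
  have "charfun \<mu> (2 ^ m *\<^sub>R (1/2) ^ n *\<^sub>R z) \<noteq> 0" for m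
  proof (induction m)
    case (Suc m)
    then show ?case using double[of "2 ^ m *\<^sub>R (1/2) ^ n *\<^sub>R z"] by (simp add: mult.assoc)
  qed (use n in simp)
  from this[of n] show ?thesis by (simp add: power_one_over)
qed

text \<open>Two logarithms differ by integer multiples of 2 pi i; a continuous function with such
  discrete values is constant on a connected space.\<close>

lemma continuous_log_unique:
  fixes f g :: "real^'n \<Rightarrow> complex"
  assumes "continuous_on UNIV f" "continuous_on UNIV g" "f 0 = g 0" "\<And>z. exp (f z) = exp (g z)"
  shows "f = g"
proof -
  have "(\<lambda>z. f z - g z) constant_on UNIV"
  proof (rule continuous_discrete_range_constant)
    show "connected (UNIV :: (real^'n) set)" by (rule convex_connected[OF convex_UNIV])
    show "continuous_on UNIV (\<lambda>z. f z - g z)" using assms by (intro continuous_intros)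
    fix x
    have "2 * pi \<le> norm ((f y - g y) - (f x - g x))" if "f y - g y \<noteq> f x - g x" for y
    proof -
      have "exp ((f y - g y) - (f x - g x)) = 1" using assms(4) by (simp add: exp_diff)
      then obtain n :: int where n: "Re ((f y - g y) - (f x - g x)) = 0"
        "Im ((f y - g y) - (f x - g x)) = of_int (2 * n) * pi"
        unfolding exp_eq_1 by blast
      then have "n \<noteq> 0" using that by (auto simp: complex_eq_iff)
      then have "1 \<le> \<bar>real_of_int n\<bar>" by linarith
      then have "2 * pi \<le> \<bar>of_int (2 * n) * pi\<bar>" by (simp add: abs_mult)
      also have "\<dots> \<le> norm ((f y - g y) - (f x - g x))"
        using abs_Im_le_cmod[of "(f y - g y) - (f x - g x)"] n by simp
      finally show ?thesis .
    qed
    then show "\<exists>e>0. \<forall>y. y \<in> UNIV \<and> f y - g y \<noteq> f x - g x \<longrightarrow> e \<le> norm (f y - g y - (f x - g x))"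
      using pi_gt_zero by (intro exI[of _ "2 * pi"]) auto
  qed
  then obtain c where "\<And>z. f z - g z = c" by (auto simp: constant_on_def)
  with assms(3) show ?thesis by (metis eq_iff_diff_eq_0 ext)
qed

lemma log_charfun_eqI:
  assumes "continuous_on UNIV \<phi>" "\<phi> 0 = 0" "\<And>z. exp (\<phi> z) = charfun \<mu> z"
  shows "log_charfun \<mu> = \<phi>"
  unfolding log_charfun_def
  by (rule the_equality) (use assms in \<open>auto intro!: continuous_log_unique\<close>)

lemma nonzero_charfun_log:
  fixes \<mu> :: "(real^'n) measure"
  assumes \<mu>: "\<mu> \<in> distributions" and nz: "\<And>z. charfun \<mu> z \<noteq> 0"
  shows "continuous_on UNIV (log_charfun \<mu>)" "log_charfun \<mu> 0 = 0" "exp (log_charfun \<mu> z) = charfun \<mu> z"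
proof -
  obtain g where g: "continuous_on UNIV g" "\<And>z. charfun \<mu> z = exp (g z)"
    using continuous_logarithm_on_contractible[OF continuous_charfun[OF \<mu>] convex_imp_contractible[OF convex_UNIV]] nz
    by auto
  have "exp (g 0) = 1" using g(2) charfun_0[OF \<mu>] by metis
  then have "log_charfun \<mu> = (\<lambda>z. g z - g 0)"
    using g by (intro log_charfun_eqI continuous_intros) (auto simp: exp_diff)
  then show "continuous_on UNIV (log_charfun \<mu>)" "log_charfun \<mu> 0 = 0" "exp (log_charfun \<mu> z) = charfun \<mu> z"
    using g \<open>exp (g 0) = 1\<close> by (auto simp: exp_diff intro!: continuous_intros)
qed

text \<open>Decides which complex (k + 1)-th root occurs: k + 1 times the continuous logarithm for
  \<open>\<nu>\<close> is one for its power, and uniqueness identifies the two.\<close>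

lemma charfun_conv_root:
  fixes \<nu> :: "(real^'n) measure"
  assumes \<nu>: "\<nu> \<in> distributions" and \<mu>: "conv_power \<nu> (Suc k) \<in> inf_divisible"
  shows "charfun \<nu> z = exp (log_charfun (conv_power \<nu> (Suc k)) z / of_nat (Suc k))"
proof -
  have pow: "charfun (conv_power \<nu> (Suc k)) v = charfun \<nu> v ^ Suc k" for v
    by (rule charfun_conv_power[OF \<nu>])
  have nz: "charfun \<nu> v \<noteq> 0" for v
    using inf_divisible_charfun_nonzero[OF \<mu>, of v] unfolding pow by auto
  note log = nonzero_charfun_log[OF \<nu> nz]
  have "log_charfun (conv_power \<nu> (Suc k)) = (\<lambda>z. of_nat (Suc k) * log_charfun \<nu> z)"
    using log by (intro log_charfun_eqI continuous_intros) (auto simp: pow exp_of_nat_mult simp del: of_nat_Suc power_Suc conv_power.simps)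
  then show ?thesis using log by (simp del: of_nat_Suc)
qed

section \<open>Real powers of Laplace transforms\<close>

text \<open>Truncation by max makes the integrand bounded and continuous on the whole space, as weak
  convergence requires, without changing the integral on the half-space.\<close>

lemma
  assumes \<rho>: "\<rho> \<in> distributions" and nonneg: "AE x in \<rho>. 0 \<le> w \<bullet> x"
  shows lap_halfspace_eq_integral: "enn2real (lap \<rho> w) = (\<integral>x. exp (- max 0 (w \<bullet> x)) \<partial>\<rho>)"
    and lap_halfspace_pos: "0 < enn2real (lap \<rho> w)"
proof -
  interpret R: prob_space \<rho> using distributionsD[OF \<rho>] by simp
  note [measurable_cong] = distributionsD(2)[OF \<rho>]
  have "lap \<rho> w = (\<integral>\<^sup>+x. ennreal (exp (- max 0 (w \<bullet> x))) \<partial>\<rho>)"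
    unfolding lap_def using nonneg by (intro nn_integral_cong_AE) (auto elim!: eventually_mono)
  then show "enn2real (lap \<rho> w) = (\<integral>x. exp (- max 0 (w \<bullet> x)) \<partial>\<rho>)"
    by (subst integral_eq_nn_integral) auto
  have "lap \<rho> w \<le> (\<integral>\<^sup>+x. 1 \<partial>\<rho>)"
    unfolding lap_def using nonneg by (intro nn_integral_mono_AE) (auto elim!: eventually_mono)
  then have "lap \<rho> w < top" by (simp add: R.emeasure_space_1 order_le_less_trans)
  moreover have "lap \<rho> w \<noteq> 0"
    unfolding lap_def by (subst nn_integral_0_iff_AE) (auto simp: R.AE_False)
  ultimately show "0 < enn2real (lap \<rho> w)" by (simp add: enn2real_positive_iff zero_less_iff_neq_zero)
qed

lemma char_inner:
  assumes "\<rho> \<in> distributions"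
  shows "char (distr \<rho> borel (\<lambda>x. w \<bullet> x)) s = charfun \<rho> (s *\<^sub>R w)"
proof -
  note [measurable_cong] = distributionsD(2)[OF assms]
  show ?thesis unfolding char_def charfun_def by (subst integral_distr) (auto simp: cis_conv_exp)
qed

lemma real_distribution_inner:
  assumes "\<rho> \<in> distributions"
  shows "real_distribution (distr \<rho> borel (\<lambda>x. w \<bullet> x))"
proof -
  note [measurable_cong] = distributionsD(2)[OF assms]
  show ?thesis
    using prob_space.real_distribution_distr[OF distributionsD(1)[OF assms]] by simp
qed

text \<open>The powers with rational exponent \<open>p/q\<close> are distributions on the half-space, whose
  characteristic functions converge as \<open>p/q \<rightarrow> t\<close>; by the continuity theorem so do their Laplace
  transforms. This replaces an analytic continuation from the imaginary axis.\<close>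

lemma lap_powr:
  fixes \<mu> :: "(real^'n) measure"
  assumes \<mu>: "\<mu> \<in> inf_divisible" and nonneg: "AE x in \<mu>. 0 \<le> w \<bullet> x" and t: "0 \<le> t" and b: "0 < b"
    and eq: "\<And>z. charfun_powr \<mu> t z = charfun \<mu> (b *\<^sub>R z)"
  shows "enn2real (lap \<mu> w) powr t = enn2real (lap \<mu> (b *\<^sub>R w))"
proof -
  have D: "\<mu> \<in> distributions" using \<mu> by (simp add: inf_divisible_def)
  \<comment> \<open>The exponents p n / (n + 1) tend to t from below, and the denominator matches
    the (n + 1)-th root chosen further down.\<close>
  define p where "p n = nat \<lfloor>t * real (Suc n)\<rfloor>" for n
  have ratio: "(\<lambda>n. real (p n) / real (Suc n)) \<longlonglongrightarrow> t"
  proof (rule tendsto_sandwich)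
    have p: "real (p n) = of_int \<lfloor>t * real (Suc n)\<rfloor>" for n using t by (simp add: p_def)
    show "\<forall>\<^sub>F n in sequentially. t - inverse (real (Suc n)) \<le> real (p n) / real (Suc n)"
    proof (intro always_eventually allI)
      fix n
      have "t * real (Suc n) - 1 \<le> real (p n)" unfolding p by linarith
      then have "(t * real (Suc n) - 1) / real (Suc n) \<le> real (p n) / real (Suc n)"
        by (rule divide_right_mono) simp
      then show "t - inverse (real (Suc n)) \<le> real (p n) / real (Suc n)"
        by (simp add: diff_divide_distrib inverse_eq_divide)
    qed
    show "\<forall>\<^sub>F n in sequentially. real (p n) / real (Suc n) \<le> t"
    proof (intro always_eventually allI)
      fix n
      have "real (p n) \<le> t * real (Suc n)" unfolding p by linarith
      then show "real (p n) / real (Suc n) \<le> t" by (simp add: divide_le_eq)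
    qed
    show "(\<lambda>n. t - inverse (real (Suc n))) \<longlonglongrightarrow> t"
      using tendsto_diff[OF tendsto_const LIMSEQ_inverse_real_of_nat, of t] by simp
  qed simp
  obtain \<nu> where \<nu>: "\<And>n. \<nu> n \<in> distributions" "\<And>n. \<mu> = conv_power (\<nu> n) (Suc n)"
  proof -
    have "\<forall>n. \<exists>\<nu>. \<nu> \<in> distributions \<and> \<mu> = conv_power \<nu> (Suc n)"
      using inf_divisible_rootE[OF \<mu>] by blast
    then show ?thesis using that by metis
  qed
  define \<rho> where "\<rho> n = conv_power (\<nu> n) (p n)" for n
  have \<rho>: "\<rho> n \<in> distributions" for n unfolding \<rho>_def by (intro conv_power_in_distributions \<nu>)
  have \<nu>_nonneg: "AE x in \<nu> n. 0 \<le> w \<bullet> x" for n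
    using nonneg by (subst (asm) \<nu>(2)[of n]) (rule AE_nonneg_conv_root[OF \<nu>(1)])
  have \<rho>_nonneg: "AE x in \<rho> n. 0 \<le> w \<bullet> x" for n
    unfolding \<rho>_def by (intro AE_nonneg_conv_power \<nu> \<nu>_nonneg)
  have b_nonneg: "AE x in \<mu>. 0 \<le> (b *\<^sub>R w) \<bullet> x"
    using nonneg by eventually_elim (use b in simp)
  have "charfun (\<rho> n) z = exp (of_real (real (p n) / real (Suc n)) * log_charfun \<mu> z)" for n z
  proof -
    have "charfun (\<rho> n) z = charfun (\<nu> n) z ^ p n" unfolding \<rho>_def by (rule charfun_conv_power[OF \<nu>(1)])
    also have "charfun (\<nu> n) z = exp (log_charfun \<mu> z / of_nat (Suc n))"
      using charfun_conv_root[OF \<nu>(1), of n n z] \<mu> \<nu>(2)[of n] by simp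
    finally show ?thesis by (simp add: field_simps flip: exp_of_nat_mult)
  qed
  moreover have "(\<lambda>n. exp (of_real (real (p n) / real (Suc n)) * log_charfun \<mu> z)) \<longlonglongrightarrow> charfun_powr \<mu> t z" for z
    unfolding charfun_powr_def by (intro tendsto_intros ratio)
  ultimately have "(\<lambda>n. charfun (\<rho> n) z) \<longlonglongrightarrow> charfun \<mu> (b *\<^sub>R z)" for z by (simp add: eq)
  \<comment> \<open>Only the projections x |-> w . x matter, so the one-dimensional continuity
    theorem suffices; the factor b is moved from the argument to w.\<close>
  then have "weak_conv_m (\<lambda>n. distr (\<rho> n) borel (\<lambda>x. w \<bullet> x)) (distr \<mu> borel (\<lambda>x. (b *\<^sub>R w) \<bullet> x))"
    by (intro levy_continuity real_distribution_inner \<rho> D)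
       (simp only: char_inner[OF \<rho>] char_inner[OF D] scaleR_left_commute[of _ b])
  then have "(\<lambda>n. \<integral>u. exp (- max 0 u) \<partial>distr (\<rho> n) borel (\<lambda>x. w \<bullet> x))
      \<longlonglongrightarrow> (\<integral>u. exp (- max 0 u) \<partial>distr \<mu> borel (\<lambda>x. (b *\<^sub>R w) \<bullet> x))"
    by (intro weak_conv_imp_integral_bdd_continuous_conv[where B=1] real_distribution_inner \<rho> D)
       (auto intro!: continuous_intros)
  moreover have "(\<integral>u. exp (- max 0 u) \<partial>distr \<tau> borel (\<lambda>x. v \<bullet> x)) = enn2real (lap \<tau> v)"
    if "\<tau> \<in> distributions" "AE x in \<tau>. 0 \<le> v \<bullet> x" for \<tau> :: "(real^'n) measure" and v
  proof -
    note [measurable_cong] = distributionsD(2)[OF that(1)]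
    show ?thesis unfolding lap_halfspace_eq_integral[OF that] by (subst integral_distr) auto
  qed
  ultimately have "(\<lambda>n. enn2real (lap (\<rho> n) w)) \<longlonglongrightarrow> enn2real (lap \<mu> (b *\<^sub>R w))"
    using \<rho> \<rho>_nonneg D b_nonneg by (simp del: inner_scaleR_left)
  moreover have "enn2real (lap (\<rho> n) w) = enn2real (lap \<mu> w) powr (real (p n) / real (Suc n))" for n
  proof -
    \<comment> \<open>The Laplace transforms of \<open>\<mu>\<close> and of \<open>\<rho> n\<close>
      are the powers a^(n + 1) and a^(p n) of one positive number.\<close>
    define a where "a = enn2real (lap (\<nu> n) w)"
    have a: "0 < a" unfolding a_def by (rule lap_halfspace_pos[OF \<nu>(1) \<nu>_nonneg])
    have "enn2real (lap \<mu> w) = a ^ Suc n"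
      unfolding a_def by (subst \<nu>(2)[of n]) (simp only: lap_conv_power[OF \<nu>(1)] enn2real_power)
    also have "\<dots> = a powr real (Suc n)" using a by (simp only: powr_realpow)
    finally have "enn2real (lap \<mu> w) powr (real (p n) / real (Suc n)) = a powr real (p n)"
      by (simp add: powr_powr del: of_nat_Suc)
    also have "\<dots> = enn2real (lap (\<rho> n) w)"
      using a by (simp add: powr_realpow \<rho>_def lap_conv_power[OF \<nu>(1)] enn2real_power a_def)
    finally show ?thesis by simp
  qed
  moreover have "(\<lambda>n. enn2real (lap \<mu> w) powr (real (p n) / real (Suc n))) \<longlonglongrightarrow> enn2real (lap \<mu> w) powr t"
    using lap_halfspace_pos[OF D nonneg] by (intro tendsto_intros ratio) auto
  ultimately show ?thesis by (simp add: LIMSEQ_unique)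
qed

text \<open>The characteristic function of a mixture over the cone is real and positive, so its real
  logarithm is the continuous logarithm and the powers are ordinary real powers.\<close>

lemma charfun_powr_mix:
  fixes \<mu> :: "(real^('d::{finite,linorder} ltri)) measure"
  assumes \<mu>: "\<mu> \<in> distributions" and cone: "on_cone \<mu>"
  shows "charfun_powr (mix \<mu>) t z = of_real (enn2real (lap \<mu> ((1/2) *\<^sub>R quad_vec z)) powr t)"
proof -
  define r where "r z = enn2real (lap \<mu> ((1/2) *\<^sub>R quad_vec z))" for z
  have cf: "charfun (mix \<mu>) z = of_real (r z)" for z by (simp add: charfun_mix \<mu> cone r_def)
  have pos: "0 < r z" for z
    unfolding r_def using cone unfolding on_cone_iff
    by (intro lap_halfspace_pos[OF \<mu>]) (auto elim!: eventually_mono)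
  have "continuous_on UNIV (\<lambda>z. Re (charfun (mix \<mu>) z))"
    by (intro continuous_intros continuous_charfun mix_in_distributions \<mu>)
  then have "continuous_on UNIV r" by (simp add: cf)
  moreover have "r 0 = 1" using charfun_0[OF mix_in_distributions[OF \<mu>]] cf[of 0] by simp
  ultimately have "log_charfun (mix \<mu>) = (\<lambda>z. of_real (ln (r z)))"
    using pos less_imp_neq[OF pos]
    by (intro log_charfun_eqI continuous_intros) (auto simp: cf exp_of_real)
  then show ?thesis
    using pos[of z] by (simp add: charfun_powr_def powr_def r_def exp_of_real flip: of_real_mult)
qed

text \<open>The exponent b^alpha is unchanged, being (b^(1/2))^(2 alpha), and scaling z by b^(1/2)
  scales \<open>quad_vec z\<close> by b; the identity is then \<open>lap_powr\<close> at w =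
  \<open>quad_vec z\<close> / 2.\<close>

lemma strictly_semistable_mix:
  fixes \<mu> :: "(real^('d::{finite,linorder} ltri)) measure"
  assumes cone: "on_cone \<mu>" and \<alpha>: "\<alpha> \<le> 1" and ss: "strictly_semistable \<alpha> b \<mu>"
  shows "strictly_semistable (2 * \<alpha>) (b powr (1/2)) (mix \<mu>)"
proof -
  have \<alpha>0: "0 < \<alpha>" and b: "1 < b" and \<mu>: "\<mu> \<in> inf_divisible"
    and eq: "\<And>z. charfun_powr \<mu> (b powr \<alpha>) z = charfun \<mu> (b *\<^sub>R z)"
    using ss by (auto simp: strictly_semistable_def)
  have D: "\<mu> \<in> distributions" using \<mu> by (simp add: inf_divisible_def)
  have b1: "1 < b powr (1/2)" using b by (simp add: powr_half_sqrt)
  have "charfun_powr (mix \<mu>) ((b powr (1/2)) powr (2 * \<alpha>)) z = charfun (mix \<mu>) (b powr (1/2) *\<^sub>R z)" for z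
  proof -
    have "AE x in \<mu>. 0 \<le> (1/2) *\<^sub>R quad_vec z \<bullet> x"
      using cone unfolding on_cone_iff by (auto elim!: eventually_mono)
    from lap_powr[OF \<mu> this _ _ eq] b
    have "enn2real (lap \<mu> ((1/2) *\<^sub>R quad_vec z)) powr (b powr \<alpha>) = enn2real (lap \<mu> (b *\<^sub>R (1/2) *\<^sub>R quad_vec z))"
      by simp
    moreover have "quad_vec (b powr (1/2) *\<^sub>R z) = b *\<^sub>R quad_vec z"
      using b by (simp add: quad_vec_scaleR powr_half_sqrt)
    moreover have "(b powr (1/2)) powr (2 * \<alpha>) = b powr \<alpha>" by (simp add: powr_powr)
    ultimately show ?thesis
      by (simp add: charfun_powr_mix charfun_mix D cone mult.commute)
  qed
  then show ?thesis
    using \<alpha>0 \<alpha> b1 inf_divisible_mix[OF \<mu> cone] by (simp add: strictly_semistable_def)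
qed

theorem proposition3p4:
  fixes M :: "'w measure"
    and X :: "'w \<Rightarrow> real^('d :: {finite, linorder})"
    and Z :: "'w \<Rightarrow> real^('d :: {finite, linorder})^('d :: {finite, linorder})"
    and \<sigma> :: "(real^('d :: {finite, linorder})) measure"
  assumes "multG_repr M X Z \<sigma>"
  shows "(\<forall>(m :: enat) (b :: real). 1 < b \<longrightarrow>
            tri_law M Z \<in> L_class m (inverse b) \<longrightarrow> \<sigma> \<in> L_class m (b powr (- 1 / 2)))
       \<and> (\<forall>(\<alpha>' :: real) (b :: real). 0 < \<alpha>' \<longrightarrow> \<alpha>' \<le> 1 \<longrightarrow> 1 < b \<longrightarrow>
            strictly_semistable \<alpha>' b (tri_law M Z) \<longrightarrow>
            strictly_semistable (2 * \<alpha>') (b powr (1 / 2)) \<sigma>)"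
proof (intro conjI allI impI)
  note \<sigma> = multG_repr_eq_mix(1)[OF assms] and cone = multG_repr_eq_mix(2)[OF assms]
  fix m :: enat and b :: real
  assume b: "1 < b" and L: "tri_law M Z \<in> L_class m (inverse b)"
  \<comment> \<open>Matches the reciprocal of the new span with sqrt c for c = 1 / b.\<close>
  have "b powr (- 1 / 2) = sqrt (inverse b)"
    using b by (simp add: powr_minus powr_half_sqrt real_sqrt_inverse flip: minus_divide_left)
  then show "\<sigma> \<in> L_class m (b powr (- 1 / 2))"
    using L_class_mix[OF _ _ cone L] b by (simp add: \<sigma> inverse_less_1_iff)
next
  fix \<alpha>' b :: real
  assume "\<alpha>' \<le> 1" "strictly_semistable \<alpha>' b (tri_law M Z)"
  then show "strictly_semistable (2 * \<alpha>') (b powr (1 / 2)) \<sigma>"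
    using strictly_semistable_mix multG_repr_eq_mix[OF assms] by metis
qed

end
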